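(* For the complex Gaussian three-user interference channel with outputs $Y_i=\sum_{k=1}^{3}h_{i,k}X_k+Z_i$, $i\in\{1,2,3\}$, every rate triplet $(R_1,R_2,R_3)$ in the capacity region satisfies $$R_1+R_2+R_3\leq \min_{\pi}\Big\{\sum_{k=1}^{3} f_{k,\pi_k}\Big\},$$ where the minimum is over all permutations $\pi=(\pi_1,\pi_2,\pi_3)$ of $(1,2,3)$ and, for $(j,k)\in\{1,2,3\}^2$, $$f_{j,k}=\log\left(\frac{1+|\boldsymbol{r}_j\boldsymbol{r}_{\backslash k}^H|\,(q+\sqrt{q^2-1})}{1+\|\boldsymbol{r}_{\backslash k}\|^2}\right),\qquad q=\frac{(1+\|\boldsymbol{r}_j\|^2)(1+\|\boldsymbol{r}_{\backslash k}\|^2)-|\boldsymbol{r}_j\boldsymbol{r}_{\backslash k}^H|^2-1}{2|\boldsymbol{r}_j\boldsymbol{r}_{\backslash k}^H|}\geq 1 .$$ Here $\boldsymbol{r}_k=(h_{k,1},h_{k,2},h_{k,3})$ is the row vector of channel coefficients seen at receiver $k$, and $\boldsymbol{r}_{\backslash k}$ equals $\boldsymbol{r}_k$ except that its $k$-th entry is replaced by zero. When $\boldsymbol{r}_j\boldsymbol{r}_{\backslash k}^H=0$, $f_{j,k}$ is understood as its limiting value $\log(1+\|\boldsymbol{r}_j\|^2)$.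
   Context: Gaussian three-user interference channel (3-IFC): source $i\in\{1,2,3\}$ encodes a message $W_i$ of rate $R_i\ge 0$ (the three messages are independent and uniform) into a complex codeword $X_i^n$ of length $n$ subject to the power constraint $\mathbb{E}[|X_i|^2]\le 1$ (average per-codeword power at most $1$). The channel is memoryless with outputs $Y_i=\sum_{k=1}^3 h_{i,k}X_k+Z_i$, where $Z_i\sim\mathcal{N}(0,1)$ is independent of the inputs and i.i.d. over time. Here $\mathcal{N}(0,1)$ denotes the circularly symmetric complex Gaussian law of zero mean and unit variance. The complex gains $h_{i,k}$ are fixed and known to all terminals; the direct gains $h_{i,i}$ are taken real and strictly positive. Destination $i$ observes $Y_i^n$ and must decode $W_i$; there is no cooperation among sources or destinations. The capacity region is the convex closure of the set of rate triplets for which there are codes whose error probability goes to zero as $n\to\infty$; it depends only on the marginal distributions of the noises. $(\cdot)^H$ denotes conjugate transpose and $\|\cdot\|$ the Euclidean norm. Rates are measured in the same logarithm base as $\log$. *)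

theory Defs
  imports "HOL-Analysis.Analysis" "HOL-Probability.Probability" "HOL-Probability.Product_PMF"
begin

(* Users are indexed by the three-element type 3, whose elements are 1, 2, 3 (with 3 = 0).
   The gain matrix is h :: complex^3^3: the gain from source k to destination i is h $ i $ k,
   so h $ i is the row vector of receiver i. *)

text \<open>Circularly symmetric complex Gaussian of unit variance: real and imaginary part are
  independent, each of variance 1/2. The library's \<^const>\<open>normal_density\<close> takes the standard
  deviation.\<close>

definition complex_gaussian :: "complex measure" where
  "complex_gaussian =
     distr (density lborel (normal_density 0 (1 / sqrt 2)) \<Otimes>\<^sub>M
            density lborel (normal_density 0 (1 / sqrt 2)))
       borel (\<lambda>(x, y). Complex x y)"

definition noise :: "nat \<Rightarrow> (nat \<Rightarrow> complex) measure" where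
  "noise n = PiM {..<n} (\<lambda>_. complex_gaussian)"

definition messages :: "(3 \<Rightarrow> nat) \<Rightarrow> (3 \<Rightarrow> nat) pmf" where
  "messages M = Pi_pmf UNIV 0 (\<lambda>i. pmf_of_set {..<M i})"

text \<open>An encoder family \<open>x\<close> sends message \<open>w\<close> of user \<open>i\<close> to the codeword with entries
  \<open>x i w t\<close>, \<open>t < n\<close>; \<open>M i\<close> is the number of messages of user \<open>i\<close>.\<close>

definition received ::
  "complex^3^3 \<Rightarrow> nat \<Rightarrow> (3 \<Rightarrow> nat \<Rightarrow> nat \<Rightarrow> complex) \<Rightarrow> 3 \<Rightarrow> (3 \<Rightarrow> nat) \<Rightarrow> (nat \<Rightarrow> complex) \<Rightarrow> (nat \<Rightarrow> complex)"
where
  "received h n x i w z = (\<lambda>t\<in>{..<n}. (\<Sum>k\<in>UNIV. h $ i $ k * x k (w k) t) + z t)"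

text \<open>The power is averaged over time and over the uniform message of the user. A decoder may
  output any natural number; a number that is not a message counts as an error below.\<close>

definition is_code ::
  "nat \<Rightarrow> (3 \<Rightarrow> nat) \<Rightarrow> (3 \<Rightarrow> nat \<Rightarrow> nat \<Rightarrow> complex) \<Rightarrow> (3 \<Rightarrow> (nat \<Rightarrow> complex) \<Rightarrow> nat) \<Rightarrow> bool"
where
  "is_code n M x d \<longleftrightarrow>
     (\<forall>i. measure_pmf.expectation (messages M) (\<lambda>w. (\<Sum>t<n. (cmod (x i (w i) t))\<^sup>2) / real n) \<le> 1) \<and>
     (\<forall>i. d i \<in> measurable (PiM {..<n} (\<lambda>_. borel)) (count_space UNIV))"

text \<open>The event that destination \<open>i\<close> errs involves the noise at that destination only, so no
  joint law of the noises at different destinations has to be fixed. Since the union of the three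
  events has probability between the largest and the sum of the three, all three error
  probabilities vanish iff the probability that some destination errs does.\<close>

definition error_prob ::
  "complex^3^3 \<Rightarrow> nat \<Rightarrow> (3 \<Rightarrow> nat) \<Rightarrow> (3 \<Rightarrow> nat \<Rightarrow> nat \<Rightarrow> complex) \<Rightarrow>
   (3 \<Rightarrow> (nat \<Rightarrow> complex) \<Rightarrow> nat) \<Rightarrow> 3 \<Rightarrow> real"
where
  "error_prob h n M x d i =
     measure (measure_pmf (messages M) \<Otimes>\<^sub>M noise n)
       {(w, z) \<in> space (measure_pmf (messages M) \<Otimes>\<^sub>M noise n). d i (received h n x i w z) \<noteq> w i}"

text \<open>\<open>b\<close> is the base of the logarithm in which rates are measured.\<close>

definition num_messages :: "real \<Rightarrow> real^3 \<Rightarrow> nat \<Rightarrow> 3 \<Rightarrow> nat" where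
  "num_messages b R n i = nat \<lceil>b powr (real n * R $ i)\<rceil>"

definition achievable :: "real \<Rightarrow> complex^3^3 \<Rightarrow> real^3 \<Rightarrow> bool" where
  "achievable b h R \<longleftrightarrow>
     (\<forall>i. 0 \<le> R $ i) \<and>
     (\<exists>x d. (\<forall>n. is_code n (num_messages b R n) (x n) (d n)) \<and>
            (\<forall>i. (\<lambda>n. error_prob h n (num_messages b R n) (x n) (d n) i) \<longlonglongrightarrow> 0))"

definition capacity_region :: "real \<Rightarrow> complex^3^3 \<Rightarrow> (real^3) set" where
  "capacity_region b h = closure (convex hull {R. achievable b h R})"

definition row_without :: "complex^3^3 \<Rightarrow> 3 \<Rightarrow> complex^3" where
  "row_without h k = (\<chi> l. if l = k then 0 else h $ k $ l)"

definition row_times_adjoint :: "complex^3 \<Rightarrow> complex^3 \<Rightarrow> complex" where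
  "row_times_adjoint u v = (\<Sum>l\<in>UNIV. u $ l * cnj (v $ l))"

definition corr :: "complex^3^3 \<Rightarrow> 3 \<Rightarrow> 3 \<Rightarrow> complex" where
  "corr h j k = row_times_adjoint (h $ j) (row_without h k)"

definition q_term :: "complex^3^3 \<Rightarrow> 3 \<Rightarrow> 3 \<Rightarrow> real" where
  "q_term h j k =
     ((1 + (norm (h $ j))\<^sup>2) * (1 + (norm (row_without h k))\<^sup>2) - (cmod (corr h j k))\<^sup>2 - 1)
       / (2 * cmod (corr h j k))"

definition f_term :: "real \<Rightarrow> complex^3^3 \<Rightarrow> 3 \<Rightarrow> 3 \<Rightarrow> real" where
  "f_term b h j k =
     (if corr h j k = 0 then log b (1 + (norm (h $ j))\<^sup>2)
      else log b ((1 + cmod (corr h j k) * (q_term h j k + sqrt ((q_term h j k)\<^sup>2 - 1)))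
                  / (1 + (norm (row_without h k))\<^sup>2)))"

end

theory Submission
  imports Defs
begin

text \<open>By Fano's inequality the rate of user \<open>k\<close> is at most \<open>(h(Y\<^sub>k) - h(S\<^sub>k)) / n\<close>, where \<open>S\<^sub>k\<close> is the
  interference plus noise at destination \<open>k\<close>, so the sum rate is at most
  the sum of \<open>(h(Y\<^sub>k) - h(S\<^sub>\<pi>\<^sub>k)) / n\<close> for every permutation \<open>\<pi>\<close>. Each difference
  equals \<open>h(Y\<^sub>j | S\<^sub>k) - h(S\<^sub>k | Y\<^sub>j)\<close> for any joint law of the two noises; the first term is at
  most the entropy of a Gaussian with the linear estimation error as variance, the second at least the entropy
  of one noise given the other. Minimising over the correlation \<open>r\<close> of the noises gives
  \<open>r + 1/r = 2q\<close> and hence \<open>f\<^sub>j\<^sub>k\<close>.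
  All entropy inequalities are instances of \<open>E ln G \<le> E G - 1\<close> for an explicit ratio \<open>G\<close> of
  Gaussian mixtures.\<close>

section \<open>Complex Gaussian vectors\<close>

text \<open>Permuting is free because the summed Fano bounds split into entropies of single outputs
  and single interferences, each depending on one noise marginal only. Hence every pair (j, k) may
  use its own noise correlation, and no joint law of the three noises has to serve all pairs at
  once. For one pair there is a trade-off: a larger r makes Y easier to predict from S, but leaves
  less randomness in one noise given the other. The phase of the correlation is aligned with that of
  the signal correlation, so only moduli survive in \<open>f_term\<close>. Two obstacles shape the
  argument. Codewords may have nonzero mean, so the estimator of Y must be affine rather than
  linear. At q = 1 the optimum is r = 1, where one noise determines the other and the bound
  degenerates, so this case is reached by a limit. Since there are finitely many messages, every law
  is a finite Gaussian mixture, whose logarithm is integrable against the noise.\<close>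

definition cgauss1 :: "real \<Rightarrow> complex \<Rightarrow> real" where
  "cgauss1 s z = exp (- (cmod z)\<^sup>2 / s) / (pi * s)"

definition cgauss :: "nat \<Rightarrow> real \<Rightarrow> (nat \<Rightarrow> complex) \<Rightarrow> real" where
  "cgauss n s z = (\<Prod>t<n. cgauss1 s (z t))"

abbreviation lebesgue_seq :: "nat \<Rightarrow> (nat \<Rightarrow> complex) measure" where
  "lebesgue_seq n \<equiv> PiM {..<n} (\<lambda>_. lborel)"

abbreviation real_gaussian :: "real measure" where
  "real_gaussian \<equiv> density lborel (normal_density 0 (1 / sqrt 2))"

lemma measurable_Complex [measurable]: "(\<lambda>(x, y). Complex x y) \<in> borel \<Otimes>\<^sub>M borel \<rightarrow>\<^sub>M borel"
  unfolding Complex_eq case_prod_unfold by measurable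

text \<open>Needed to turn \<open>complex_gaussian\<close>, defined through two real coordinates,
  into a density on the plane. It suffices to compare boxes, which are products of
  intervals.\<close>

lemma lborel_complex: "(lborel :: complex measure) = distr (lborel \<Otimes>\<^sub>M lborel) borel (\<lambda>(x, y). Complex x y)"
proof (rule lborel_eqI)
  fix l u :: complex
  assume le: "\<And>b. b \<in> Basis \<Longrightarrow> l \<bullet> b \<le> u \<bullet> b"
  have le': "Re l \<le> Re u" "Im l \<le> Im u"
    using le[of 1] le[of \<i>] by (auto simp: Basis_complex_def inner_complex_def)
  have eq: "(\<lambda>(x, y). Complex x y) -` box l u \<inter> space (lborel \<Otimes>\<^sub>M lborel) = {Re l<..<Re u} \<times> {Im l<..<Im u}"
    by (auto simp: box_def Basis_complex_def inner_complex_def space_pair_measure)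
  have "emeasure (distr (lborel \<Otimes>\<^sub>M lborel) borel (\<lambda>(x, y). Complex x y)) (box l u)
      = emeasure (lborel \<Otimes>\<^sub>M lborel) ({Re l<..<Re u} \<times> {Im l<..<Im u})"
    by (subst emeasure_distr) (auto simp: eq)
  also have "\<dots> = ennreal ((Re u - Re l) * (Im u - Im l))"
    using le' by (subst lborel.emeasure_pair_measure_Times) (auto simp: ennreal_mult)
  also have "\<dots> = ennreal (\<Prod>b\<in>Basis. (u - l) \<bullet> b)"
    by (simp add: Basis_complex_def inner_complex_def)
  finally show "emeasure (distr (lborel \<Otimes>\<^sub>M lborel) borel (\<lambda>(x, y). Complex x y)) (box l u) = ennreal (\<Prod>b\<in>Basis. (u - l) \<bullet> b)" .
qed simp

lemma prob_space_real_gaussian: "prob_space real_gaussian"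
  by (rule prob_space_normal_density) simp

lemma measurable_cgauss1 [measurable]: "cgauss1 s \<in> borel_measurable borel"
  unfolding cgauss1_def by measurable

lemma cgauss1_pos: "0 < s \<Longrightarrow> 0 < cgauss1 s z"
  by (simp add: cgauss1_def)

lemma complex_gaussian_eq: "complex_gaussian = density lborel (\<lambda>z. ennreal (cgauss1 1 z))"
proof -
  interpret prob_space real_gaussian by (rule prob_space_real_gaussian)
  have "complex_gaussian = distr (density (lborel \<Otimes>\<^sub>M lborel)
      (\<lambda>(x, y). ennreal (normal_density 0 (1 / sqrt 2) x) * ennreal (normal_density 0 (1 / sqrt 2) y)))
       borel (\<lambda>(x, y). Complex x y)"
    unfolding complex_gaussian_def
    by (subst pair_measure_density) (auto intro: lborel.sigma_finite_measure_axioms sigma_finite_measure_axioms)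
  also have "(\<lambda>(x, y). ennreal (normal_density 0 (1 / sqrt 2) x) * ennreal (normal_density 0 (1 / sqrt 2) y))
      = (\<lambda>p. ennreal (cgauss1 1 (case p of (x, y) \<Rightarrow> Complex x y)))"
    by (auto simp: fun_eq_iff cgauss1_def normal_density_def ennreal_mult' [symmetric] power_divide
        cmod_def exp_add[symmetric] algebra_simps)
  also have "distr (density (lborel \<Otimes>\<^sub>M lborel) \<dots>) borel (\<lambda>(x, y). Complex x y)
     = density (distr (lborel \<Otimes>\<^sub>M lborel) borel (\<lambda>(x, y). Complex x y)) (\<lambda>z. ennreal (cgauss1 1 z))"
    by (subst density_distr) auto
  finally show ?thesis by (simp add: lborel_complex[symmetric])
qed

lemma prob_space_complex_gaussian: "prob_space complex_gaussian"
proof -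
  interpret prob_space real_gaussian by (rule prob_space_real_gaussian)
  interpret pair_prob_space real_gaussian real_gaussian ..
  show ?thesis unfolding complex_gaussian_def
    by (rule prob_space_distr) simp
qed

lemma sets_complex_gaussian [measurable_cong, simp]: "sets complex_gaussian = sets borel"
  by (simp add: complex_gaussian_def)

text \<open>For s = 1 this is the total mass of \<open>complex_gaussian\<close>; scaling by
  \<open>sqrt s\<close> gives the rest, with Jacobian s because the plane has real dimension
  2.\<close>

lemma nn_integral_cgauss1:
  assumes "0 < s" shows "(\<integral>\<^sup>+z. ennreal (cgauss1 s z) \<partial>lborel) = 1"
proof -
  interpret prob_space complex_gaussian by (rule prob_space_complex_gaussian)
  have 1: "(\<integral>\<^sup>+z. ennreal (cgauss1 1 z) \<partial>lborel) = 1"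
    using emeasure_space_1 unfolding complex_gaussian_eq by (simp add: emeasure_density)
  have "(\<integral>\<^sup>+z. ennreal (cgauss1 s z) \<partial>lborel) =
    (\<integral>\<^sup>+z. ennreal (cgauss1 s z) \<partial>density (distr lborel borel (\<lambda>x. 0 + sqrt s *\<^sub>R x)) (\<lambda>_. ennreal (\<bar>sqrt s\<bar>^DIM(complex))))"
    using assms by (subst (1) lborel_affine[of "sqrt s" 0]) auto
  also have "\<dots> = (\<integral>\<^sup>+z. ennreal s * ennreal (cgauss1 s (sqrt s *\<^sub>R z)) \<partial>lborel)"
    using assms by (subst nn_integral_density; simp add: nn_integral_distr)
  also have "\<dots> = (\<integral>\<^sup>+z. ennreal (cgauss1 1 z) \<partial>lborel)"
    using assms by (intro nn_integral_cong) (auto simp: ennreal_mult'[symmetric] cgauss1_def power_mult_distrib)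
  finally show ?thesis using 1 by simp
qed

interpretation lborel_seq: product_sigma_finite "\<lambda>_::nat. lborel :: complex measure"
  by standard

lemma sigma_finite_lebesgue_seq: "sigma_finite_measure (lebesgue_seq n)"
  by (rule lborel_seq.sigma_finite) simp

lemma measurable_cgauss [measurable (raw)]:
  assumes "\<And>t. t < n \<Longrightarrow> (\<lambda>x. f x t) \<in> borel_measurable M"
  shows "(\<lambda>x. cgauss n s (f x)) \<in> borel_measurable M"
  unfolding cgauss_def using assms by measurable

lemma cgauss_pos: "0 < s \<Longrightarrow> 0 < cgauss n s z"
  by (auto simp: cgauss_def intro!: prod_pos cgauss1_pos)

lemma cgauss_eq:
  assumes "0 < s"
  shows "cgauss n s z = exp (- (\<Sum>t<n. (cmod (z t))\<^sup>2) / s) / (pi * s) ^ n"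
  by (simp add: cgauss_def cgauss1_def prod_dividef exp_sum sum_negf[symmetric] sum_divide_distrib)

lemma ln_cgauss:
  assumes "0 < s"
  shows "ln (cgauss n s z) = - (\<Sum>t<n. (cmod (z t))\<^sup>2) / s - real n * ln (pi * s)"
  using assms by (simp add: cgauss_eq ln_div ln_realpow)

section \<open>Affine changes of variables in n complex coordinates\<close>

lemma lborel_complex_affine:
  fixes c :: complex
  assumes "0 < \<tau>"
  shows "lborel = density (distr lborel borel (\<lambda>x. c + of_real \<tau> * x)) (\<lambda>_. ennreal (\<tau>\<^sup>2))"
  using lborel_affine[of \<tau> c] assms by (simp add: scaleR_conv_of_real)

lemma measurable_affine_seq [measurable]:
  fixes c :: "nat \<Rightarrow> complex"
  shows "(\<lambda>z. \<lambda>t\<in>{..<n}. c t + a * z t) \<in> lebesgue_seq n \<rightarrow>\<^sub>M lebesgue_seq n"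
proof (rule measurable_restrict)
  fix t assume "t \<in> {..<n}"
  then have "(\<lambda>z. z t) \<in> lebesgue_seq n \<rightarrow>\<^sub>M (lborel :: complex measure)"
    by (rule measurable_component_singleton)
  then have "(\<lambda>z. z t) \<in> borel_measurable (lebesgue_seq n)" by simp
  then show "(\<lambda>z. c t + a * z t) \<in> lebesgue_seq n \<rightarrow>\<^sub>M lborel"
    by simp
qed

text \<open>Checked on rectangles, one coordinate at a time. Each complex coordinate contributes
  \<open>\<tau>^2\<close>, whence the exponent 2 n. Restricting to \<open>{..<n}\<close> keeps the
  image in the extensional functions that make up the product space.\<close>

lemma lebesgue_seq_affine:
  fixes c :: "nat \<Rightarrow> complex"
  assumes "0 < \<tau>"
  shows "lebesgue_seq n = density (distr (lebesgue_seq n) (lebesgue_seq n) (\<lambda>z. \<lambda>t\<in>{..<n}. c t + of_real \<tau> * z t))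
    (\<lambda>_. ennreal (\<tau> ^ (2 * n)))" (is "_ = density (distr _ _ ?T) _")
proof (rule lborel_seq.PiM_eqI[symmetric])
  fix A :: "nat \<Rightarrow> complex set" assume A: "\<And>i. i \<in> {..<n} \<Longrightarrow> A i \<in> sets lborel"
  have T: "?T \<in> lebesgue_seq n \<rightarrow>\<^sub>M lebesgue_seq n"
    by (rule measurable_affine_seq)
  have PA [measurable]: "PiE {..<n} A \<in> sets (lebesgue_seq n)"
    using A by (intro sets_PiM_I_finite) auto
  have B: "(\<lambda>z. c t + of_real \<tau> * z) -` A t \<in> sets lborel" if "t < n" for t
    using measurable_sets[of "\<lambda>z. c t + of_real \<tau> * z" lborel borel "A t"] A[of t] that by simp
  have eq: "?T -` PiE {..<n} A \<inter> space (lebesgue_seq n) = PiE {..<n} (\<lambda>t. (\<lambda>z. c t + of_real \<tau> * z) -` A t)"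
    by (intro set_eqI) (simp add: space_PiM PiE_iff Ball_def)
  have one: "emeasure lborel (A t) = ennreal (\<tau>\<^sup>2) * emeasure lborel ((\<lambda>z. c t + of_real \<tau> * z) -` A t)" if "t < n" for t
  proof -
    have "emeasure lborel (A t) = emeasure (density (distr lborel borel (\<lambda>x. c t + of_real \<tau> * x)) (\<lambda>_. ennreal (\<tau>\<^sup>2))) (A t)"
      by (subst lborel_complex_affine[OF assms, of "c t"]) simp
    also have "\<dots> = ennreal (\<tau>\<^sup>2) * emeasure lborel ((\<lambda>z. c t + of_real \<tau> * z) -` A t)"
      using A[of t] that by (subst emeasure_density_const; simp add: emeasure_distr)
    finally show ?thesis .
  qed
  have PB: "emeasure (lebesgue_seq n) (PiE {..<n} (\<lambda>t. (\<lambda>z. c t + of_real \<tau> * z) -` A t))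
    = (\<Prod>t<n. emeasure lborel ((\<lambda>z. c t + of_real \<tau> * z) -` A t))"
    by (rule lborel_seq.emeasure_PiM) (auto intro: B[simplified])
  have "emeasure (density (distr (lebesgue_seq n) (lebesgue_seq n) ?T) (\<lambda>_. ennreal (\<tau> ^ (2 * n)))) (PiE {..<n} A)
    = ennreal (\<tau> ^ (2 * n)) * (\<Prod>t<n. emeasure lborel ((\<lambda>z. c t + of_real \<tau> * z) -` A t))"
    using PA by (subst emeasure_density_const; simp add: emeasure_distr[OF T] eq PB)
  also have "\<dots> = (\<Prod>t<n. ennreal (\<tau>\<^sup>2) * emeasure lborel ((\<lambda>z. c t + of_real \<tau> * z) -` A t))"
    by (simp add: prod.distrib ennreal_power power_mult)
  also have "\<dots> = (\<Prod>t<n. emeasure lborel (A t))"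
    by (intro prod.cong) (auto simp: one)
  finally show "emeasure (density (distr (lebesgue_seq n) (lebesgue_seq n) ?T) (\<lambda>_. ennreal (\<tau> ^ (2 * n)))) (PiE {..<n} A)
    = (\<Prod>i\<in>{..<n}. emeasure lborel (A i))" .
qed auto

lemma nn_integral_lebesgue_seq_affine:
  fixes c :: "nat \<Rightarrow> complex"
  assumes "0 < \<tau>" and [measurable]: "F \<in> borel_measurable (lebesgue_seq n)"
  shows "(\<integral>\<^sup>+z. ennreal (\<tau> ^ (2 * n)) * F (\<lambda>t\<in>{..<n}. c t + of_real \<tau> * z t) \<partial>lebesgue_seq n) = (\<integral>\<^sup>+y. F y \<partial>lebesgue_seq n)"
proof -
  have T: "(\<lambda>z. \<lambda>t\<in>{..<n}. c t + of_real \<tau> * z t) \<in> lebesgue_seq n \<rightarrow>\<^sub>M lebesgue_seq n"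
    by (rule measurable_affine_seq)
  show ?thesis
    by (subst (2) lebesgue_seq_affine[OF assms(1), of n c])
       (simp add: nn_integral_density nn_integral_distr[OF T])
qed

lemma nn_integral_lebesgue_seq_shift:
  fixes c :: "nat \<Rightarrow> complex"
  assumes "F \<in> borel_measurable (lebesgue_seq n)"
  shows "(\<integral>\<^sup>+z. F (\<lambda>t\<in>{..<n}. c t + z t) \<partial>lebesgue_seq n) = (\<integral>\<^sup>+y. F y \<partial>lebesgue_seq n)"
  using nn_integral_lebesgue_seq_affine[of 1 F n c] assms by simp

lemma cgauss_cong: "(\<And>t. t < n \<Longrightarrow> f t = g t) \<Longrightarrow> cgauss n s f = cgauss n s g"
  by (simp add: cgauss_def)

lemma nn_integral_cgauss:
  assumes "0 < s"
  shows "(\<integral>\<^sup>+z. ennreal (cgauss n s z) \<partial>lebesgue_seq n) = 1"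
proof -
  have "(\<integral>\<^sup>+z. ennreal (cgauss n s z) \<partial>lebesgue_seq n) = (\<integral>\<^sup>+z. (\<Prod>t<n. ennreal (cgauss1 s (z t))) \<partial>lebesgue_seq n)"
    using cgauss1_pos[OF assms] by (simp add: cgauss_def prod_ennreal less_imp_le)
  also have "\<dots> = 1"
    using assms by (subst lborel_seq.product_nn_integral_prod) (auto simp: nn_integral_cgauss1)
  finally show ?thesis .
qed

lemma nn_integral_cgauss_shift:
  assumes "0 < s"
  shows "(\<integral>\<^sup>+z. ennreal (cgauss n s (\<lambda>t. z t - c t)) \<partial>lebesgue_seq n) = 1"
proof -
  have "(\<integral>\<^sup>+z. ennreal (cgauss n s (\<lambda>t. z t - c t)) \<partial>lebesgue_seq n)
    = (\<integral>\<^sup>+z. ennreal (cgauss n s (\<lambda>t. (\<lambda>t\<in>{..<n}. c t + z t) t - c t)) \<partial>lebesgue_seq n)"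
    by (rule nn_integral_lebesgue_seq_shift[symmetric]) simp
  also have "\<dots> = (\<integral>\<^sup>+z. ennreal (cgauss n s z) \<partial>lebesgue_seq n)"
    by (intro nn_integral_cong arg_cong[where f=ennreal] cgauss_cong) simp
  finally show ?thesis using nn_integral_cgauss[OF assms] by simp
qed

lemma noise_eq: "noise n = density (lebesgue_seq n) (\<lambda>z. ennreal (cgauss n 1 z))"
proof -
  interpret G: product_sigma_finite "\<lambda>_::nat. complex_gaussian"
    by (intro product_sigma_finite.intro prob_space_imp_sigma_finite prob_space_complex_gaussian)
  have "density (lebesgue_seq n) (\<lambda>z. ennreal (cgauss n 1 z)) = PiM {..<n} (\<lambda>_. complex_gaussian)"
  proof (rule G.PiM_eqI)
    show "sets (density (lebesgue_seq n) (\<lambda>z. ennreal (cgauss n 1 z))) = sets (PiM {..<n} (\<lambda>_. complex_gaussian))"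
      by (simp cong: sets_PiM_cong)
    fix A :: "nat \<Rightarrow> complex set" assume A: "\<And>i. i \<in> {..<n} \<Longrightarrow> A i \<in> sets complex_gaussian"
    have "emeasure (density (lebesgue_seq n) (\<lambda>z. ennreal (cgauss n 1 z))) (PiE {..<n} A)
       = (\<integral>\<^sup>+z. ennreal (cgauss n 1 z) * indicator (PiE {..<n} A) z \<partial>lebesgue_seq n)"
      using A by (subst emeasure_density) (auto intro!: sets_PiM_I_finite)
    also have "\<dots> = (\<integral>\<^sup>+z. (\<Prod>t<n. ennreal (cgauss1 1 (z t)) * indicator (A t) (z t)) \<partial>lebesgue_seq n)"
    proof (intro nn_integral_cong)
      fix z assume "z \<in> space (lebesgue_seq n)"
      then have "indicator (PiE {..<n} A) z = (\<Prod>t<n. indicator (A t) (z t) :: ennreal)"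
        by (auto simp: indicator_def space_PiM PiE_iff)
      then show "ennreal (cgauss n 1 z) * indicator (PiE {..<n} A) z = (\<Prod>t<n. ennreal (cgauss1 1 (z t)) * indicator (A t) (z t))"
        using cgauss1_pos[of 1] by (simp add: cgauss_def prod.distrib prod_ennreal less_imp_le)
    qed
    also have "\<dots> = (\<Prod>t<n. emeasure complex_gaussian (A t))"
      using A by (subst lborel_seq.product_nn_integral_prod) (auto simp: complex_gaussian_eq emeasure_density)
    finally show "emeasure (density (lebesgue_seq n) (\<lambda>z. ennreal (cgauss n 1 z))) (PiE {..<n} A) = (\<Prod>i\<in>{..<n}. emeasure complex_gaussian (A i))" .
  qed simp
  then show ?thesis by (simp add: noise_def)
qed

lemma prob_space_noise: "prob_space (noise n)"
  unfolding noise_def by (intro prob_space_PiM prob_space_complex_gaussian)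

lemma sets_noise [measurable_cong, simp]: "sets (noise n) = sets (lebesgue_seq n)"
  by (simp add: noise_eq)

lemma nn_integral_noise_shift:
  assumes [measurable]: "F \<in> borel_measurable (lebesgue_seq n)"
  shows "(\<integral>\<^sup>+z. F (\<lambda>t\<in>{..<n}. c t + z t) \<partial>noise n) = (\<integral>\<^sup>+y. ennreal (cgauss n 1 (\<lambda>t. y t - c t)) * F y \<partial>lebesgue_seq n)"
proof -
  have [measurable]: "(\<lambda>z. \<lambda>t\<in>{..<n}. c t + z t) \<in> lebesgue_seq n \<rightarrow>\<^sub>M lebesgue_seq n"
    using measurable_affine_seq[of c 1 n] by simp
  have "(\<integral>\<^sup>+z. F (\<lambda>t\<in>{..<n}. c t + z t) \<partial>noise n) = (\<integral>\<^sup>+z. ennreal (cgauss n 1 z) * F (\<lambda>t\<in>{..<n}. c t + z t) \<partial>lebesgue_seq n)"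
    unfolding noise_eq by (simp add: nn_integral_density)
  also have "\<dots> = (\<integral>\<^sup>+z. ennreal (cgauss n 1 (\<lambda>t. (\<lambda>t\<in>{..<n}. c t + z t) t - c t)) * F (\<lambda>t\<in>{..<n}. c t + z t) \<partial>lebesgue_seq n)"
    by (intro nn_integral_cong arg_cong2[where f="(*)"] arg_cong[where f=ennreal] cgauss_cong) auto
  also have "\<dots> = (\<integral>\<^sup>+y. ennreal (cgauss n 1 (\<lambda>t. y t - c t)) * F y \<partial>lebesgue_seq n)"
    by (rule nn_integral_lebesgue_seq_shift) simp
  finally show ?thesis .
qed

section \<open>Second moments of the noise\<close>

lemma has_bochner_integral_real_gaussian:
  assumes "has_bochner_integral lborel (\<lambda>x. normal_density 0 (1 / sqrt 2) x * f x) c" "f \<in> borel_measurable borel"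
  shows "has_bochner_integral real_gaussian f (c::real)"
  using assms by (intro has_bochner_integral_density) auto

text \<open>Real and imaginary part have mean 0, which removes the terms linear in z, and second
  moment 1/2, so that each contributes half of \<open>(cmod C)^2\<close>.\<close>

lemma complex_gaussian_moment:
  "(\<integral>\<^sup>+z. ennreal ((cmod (A + C * z))\<^sup>2) \<partial>complex_gaussian) = ennreal ((cmod A)\<^sup>2 + (cmod C)\<^sup>2)"
proof -
  interpret G: prob_space real_gaussian by (rule prob_space_real_gaussian)
  interpret P: pair_prob_space real_gaussian real_gaussian ..
  have h1: "has_bochner_integral real_gaussian (\<lambda>x. x) 0"
    using normal_moment_nz_1[of "1 / sqrt 2" 0] by (intro has_bochner_integral_real_gaussian) auto
  have h2: "has_bochner_integral real_gaussian (\<lambda>x. x\<^sup>2) (1/2)"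
    using normal_moment_even[of "1 / sqrt 2" 0 1] by (intro has_bochner_integral_real_gaussian) (auto simp: power_divide)
  have f: "has_bochner_integral (real_gaussian \<Otimes>\<^sub>M real_gaussian) (\<lambda>p. g (fst p)) c"
    if "has_bochner_integral real_gaussian g c" for g :: "real \<Rightarrow> real" and c
  proof -
    have [measurable]: "g \<in> borel_measurable real_gaussian" using that by auto
    have "has_bochner_integral (distr (real_gaussian \<Otimes>\<^sub>M real_gaussian) real_gaussian fst) g c"
      using that by (simp add: G.distr_pair_fst)
    then show ?thesis
      by (simp add: has_bochner_integral_iff integrable_distr_eq integral_distr del: G.distr_pair_fst)
  qed
  have s: "has_bochner_integral (real_gaussian \<Otimes>\<^sub>M real_gaussian) (\<lambda>p. g (snd p)) c"
    if "has_bochner_integral real_gaussian g c" for g :: "real \<Rightarrow> real" and c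
  proof -
    have "integrable (real_gaussian \<Otimes>\<^sub>M real_gaussian) (\<lambda>p. g (fst p))"
      "(\<integral>p. g (fst p) \<partial>(real_gaussian \<Otimes>\<^sub>M real_gaussian)) = c"
      using f[OF that] by (simp_all add: has_bochner_integral_iff)
    then show ?thesis
      using P.integrable_product_swap[of "\<lambda>p. g (fst p)"] P.integral_product_swap[of "\<lambda>p. g (fst p)"]
      by (simp add: case_prod_unfold has_bochner_integral_iff)
  qed
  let ?D = "A * cnj C"
  have "has_bochner_integral (real_gaussian \<Otimes>\<^sub>M real_gaussian)
     (\<lambda>p. (cmod A)\<^sup>2 + ((cmod C)\<^sup>2 * (fst p)\<^sup>2 + (cmod C)\<^sup>2 * (snd p)\<^sup>2) + (2 * Re ?D * fst p + 2 * Im ?D * snd p))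
     ((cmod A)\<^sup>2 + ((cmod C)\<^sup>2 * (1/2) + (cmod C)\<^sup>2 * (1/2)) + (2 * Re ?D * 0 + 2 * Im ?D * 0))"
    by (intro has_bochner_integral_add has_bochner_integral_mult_right f[OF h1] f[OF h2] s[OF h1] s[OF h2])
       (simp_all add: has_bochner_integral_iff P.prob_space)
  moreover have "(cmod (A + C * Complex (fst p) (snd p)))\<^sup>2 = (cmod A)\<^sup>2 + ((cmod C)\<^sup>2 * (fst p)\<^sup>2 + (cmod C)\<^sup>2 * (snd p)\<^sup>2) + (2 * Re ?D * fst p + 2 * Im ?D * snd p)" for p
    unfolding cmod_power2 by (simp add: power2_eq_square algebra_simps)
  ultimately have "has_bochner_integral (real_gaussian \<Otimes>\<^sub>M real_gaussian) (\<lambda>p. (cmod (A + C * Complex (fst p) (snd p)))\<^sup>2) ((cmod A)\<^sup>2 + (cmod C)\<^sup>2)"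
    by simp
  then have "(\<integral>\<^sup>+p. ennreal ((cmod (A + C * Complex (fst p) (snd p)))\<^sup>2) \<partial>(real_gaussian \<Otimes>\<^sub>M real_gaussian)) = ennreal ((cmod A)\<^sup>2 + (cmod C)\<^sup>2)"
    by (simp add: nn_integral_eq_integral has_bochner_integral_iff)
  then show ?thesis
    unfolding complex_gaussian_def by (subst nn_integral_distr) (auto simp: case_prod_unfold)
qed

lemma noise_moment:
  assumes "t < n"
  shows "(\<integral>\<^sup>+z. ennreal ((cmod (A + C * z t))\<^sup>2) \<partial>noise n) = ennreal ((cmod A)\<^sup>2 + (cmod C)\<^sup>2)"
proof -
  have [measurable]: "(\<lambda>z. z t) \<in> noise n \<rightarrow>\<^sub>M complex_gaussian"
    unfolding noise_def using assms by (intro measurable_component_singleton) simp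
  have "(\<integral>\<^sup>+z. ennreal ((cmod (A + C * z t))\<^sup>2) \<partial>noise n) = (\<integral>\<^sup>+z. ennreal ((cmod (A + C * z))\<^sup>2) \<partial>distr (noise n) complex_gaussian (\<lambda>z. z t))"
    by (simp add: nn_integral_distr)
  also have "distr (noise n) complex_gaussian (\<lambda>z. z t) = complex_gaussian"
    unfolding noise_def using assms by (intro distr_PiM_component prob_space_complex_gaussian) auto
  finally show ?thesis by (simp add: complex_gaussian_moment)
qed

section \<open>Gaussian mixtures\<close>

definition mixture :: "nat \<Rightarrow> 'w pmf \<Rightarrow> ('w \<Rightarrow> nat \<Rightarrow> complex) \<Rightarrow> (nat \<Rightarrow> complex) \<Rightarrow> real" where
  "mixture n p u y = (\<Sum>w\<in>set_pmf p. pmf p w * cgauss n 1 (\<lambda>t. y t - u w t))"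

text \<open>For \<open>p\<close> of finite support, \<open>mixture n p u\<close> is the density of \<open>u W + Z\<close> with \<open>W\<close> drawn from \<open>p\<close>, and
  \<open>neg_entropy n p u\<close> is minus its differential entropy in nats.\<close>

definition neg_entropy :: "nat \<Rightarrow> 'w pmf \<Rightarrow> ('w \<Rightarrow> nat \<Rightarrow> complex) \<Rightarrow> real" where
  "neg_entropy n p u =
     (\<Sum>w\<in>set_pmf p. pmf p w * (\<integral>z. ln (mixture n p u (\<lambda>t. u w t + z t)) \<partial>noise n))"

lemma measurable_mixture [measurable (raw)]:
  assumes "\<And>t. t < n \<Longrightarrow> (\<lambda>x. f x t) \<in> borel_measurable M"
  shows "(\<lambda>x. mixture n p u (f x)) \<in> borel_measurable M"
  unfolding mixture_def using assms by measurable

lemma mixture_pos: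
  assumes "finite (set_pmf p)"
  shows "0 < mixture n p u y"
  unfolding mixture_def using assms
  by (intro sum_pos) (auto simp: set_pmf_not_empty pmf_positive cgauss_pos)

lemma mixture_cong: "(\<And>t. t < n \<Longrightarrow> f t = g t) \<Longrightarrow> mixture n p u f = mixture n p u g"
  unfolding mixture_def by (intro sum.cong refl arg_cong2[where f="(*)"] cgauss_cong) auto

lemma mixture_le:
  assumes "finite (set_pmf p)"
  shows "mixture n p u y \<le> 1 / pi ^ n"
proof -
  have "mixture n p u y \<le> (\<Sum>w\<in>set_pmf p. pmf p w * (1 / pi ^ n))"
    unfolding mixture_def
    by (intro sum_mono mult_left_mono) (auto simp: cgauss_eq sum_nonneg divide_right_mono)
  then show ?thesis by (simp add: sum_divide_distrib[symmetric] sum_pmf_eq_1[OF assms])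
qed

lemma mixture_ge:
  assumes "finite (set_pmf p)" "w \<in> set_pmf p"
  shows "pmf p w * cgauss n 1 (\<lambda>t. y t - u w t) \<le> mixture n p u y"
  unfolding mixture_def using assms
  by (intro member_le_sum) (auto simp: less_imp_le[OF cgauss_pos])

lemma nn_integral_mixture:
  assumes "finite (set_pmf p)"
  shows "(\<integral>\<^sup>+y. ennreal (mixture n p u y) \<partial>lebesgue_seq n) = 1"
proof -
  have "(\<integral>\<^sup>+y. ennreal (mixture n p u y) \<partial>lebesgue_seq n)
     = (\<integral>\<^sup>+y. (\<Sum>w\<in>set_pmf p. ennreal (pmf p w) * ennreal (cgauss n 1 (\<lambda>t. y t - u w t))) \<partial>lebesgue_seq n)"
    unfolding mixture_def
    by (intro nn_integral_cong, subst sum_ennreal[symmetric]) (auto simp: less_imp_le[OF cgauss_pos] ennreal_mult)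
  also have "\<dots> = (\<Sum>w\<in>set_pmf p. ennreal (pmf p w))"
    by (subst nn_integral_sum) (auto simp: nn_integral_cmult nn_integral_cgauss_shift)
  also have "\<dots> = 1"
    by (simp add: sum_pmf_eq_1[OF assms])
  finally show ?thesis .
qed

text \<open>The common form of all entropy inequalities below, from ln G <= G - 1. The mean of G is
  bounded in \<open>ennreal\<close>, so that it can be computed by Tonelli beforehand; finiteness of
  the sum with positive weights then makes each \<open>G w\<close> integrable.\<close>

lemma sum_pmf_ennreal_integral_ln_nonpos:
  assumes fin: "finite (set_pmf p)" and "prob_space M"
    and G: "\<And>w. w \<in> set_pmf p \<Longrightarrow> G w \<in> borel_measurable M"
    and pos: "\<And>w x. w \<in> set_pmf p \<Longrightarrow> 0 < (G w x :: real)"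
    and int: "\<And>w. w \<in> set_pmf p \<Longrightarrow> integrable M (\<lambda>x. ln (G w x))"
    and le: "(\<Sum>w\<in>set_pmf p. ennreal (pmf p w) * (\<integral>\<^sup>+x. ennreal (G w x) \<partial>M)) \<le> 1"
  shows "(\<Sum>w\<in>set_pmf p. pmf p w * (\<integral>x. ln (G w x) \<partial>M)) \<le> 0"
proof -
  interpret prob_space M by fact
  have intG: "integrable M (G w)" if w: "w \<in> set_pmf p" for w
  proof (rule integrableI_bounded)
    have "ennreal (pmf p w) * (\<integral>\<^sup>+x. ennreal (G w x) \<partial>M) \<le> (\<Sum>w\<in>set_pmf p. ennreal (pmf p w) * (\<integral>\<^sup>+x. ennreal (G w x) \<partial>M))"
      using w fin by (intro member_le_sum) auto
    also have "\<dots> < \<infinity>" using le by (auto simp: less_top[symmetric] top_unique)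
    finally have "(\<integral>\<^sup>+x. ennreal (G w x) \<partial>M) < \<infinity>"
      using pmf_positive[OF w] by (auto simp: ennreal_mult_less_top ennreal_eq_0_iff)
    then show "(\<integral>\<^sup>+x. ennreal (norm (G w x)) \<partial>M) < \<infinity>"
      using pos[OF w] by (simp add: abs_of_pos)
  qed (rule G[OF w])
  have "(\<Sum>w\<in>set_pmf p. ennreal (pmf p w) * (\<integral>\<^sup>+x. ennreal (G w x) \<partial>M)) = (\<Sum>w\<in>set_pmf p. ennreal (pmf p w * (\<integral>x. G w x \<partial>M)))"
    using intG pos by (intro sum.cong refl) (simp add: nn_integral_eq_integral less_imp_le ennreal_mult'[symmetric])
  also have "\<dots> = ennreal (\<Sum>w\<in>set_pmf p. pmf p w * (\<integral>x. G w x \<partial>M))"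
    using pos by (intro sum_ennreal) (auto intro!: mult_nonneg_nonneg integral_nonneg simp: less_imp_le)
  finally have le1: "(\<Sum>w\<in>set_pmf p. pmf p w * (\<integral>x. G w x \<partial>M)) \<le> 1"
    using le by simp
  have "(\<Sum>w\<in>set_pmf p. pmf p w * (\<integral>x. ln (G w x) \<partial>M)) \<le> (\<Sum>w\<in>set_pmf p. pmf p w * (\<integral>x. G w x - 1 \<partial>M))"
    using intG int pos by (intro sum_mono mult_left_mono integral_mono ln_le_minus_one) auto
  also have "\<dots> = (\<Sum>w\<in>set_pmf p. pmf p w * (\<integral>x. G w x \<partial>M)) - (\<Sum>w\<in>set_pmf p. pmf p w)"
    using intG by (simp add: prob_space algebra_simps sum_subtractf)
  also have "\<dots> \<le> 0" using le1 by (simp add: sum_pmf_eq_1[OF fin])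
  finally show ?thesis .
qed

lemma pair_prob_space_noise: "pair_prob_space (noise n) (noise n)"
  by (simp add: pair_prob_space_def pair_sigma_finite_def prob_space_noise prob_space_imp_sigma_finite)

lemma integrable_sq_noise: "integrable (noise n) (\<lambda>z. \<Sum>t<n. (cmod (z t))\<^sup>2)"
  and integral_sq_noise: "(\<integral>z. (\<Sum>t<n. (cmod (z t))\<^sup>2) \<partial>noise n) = real n"
proof -
  have "has_bochner_integral (noise n) (\<lambda>z. \<Sum>t<n. (cmod (z t))\<^sup>2) (\<Sum>t<n. 1)"
  proof (intro has_bochner_integral_sum)
    fix t assume "t \<in> {..<n}"
    then show "has_bochner_integral (noise n) (\<lambda>z. (cmod (z t))\<^sup>2) 1"
      using noise_moment[of t n 0 1] by (intro has_bochner_integral_nn_integral) auto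
  qed
  then show "integrable (noise n) (\<lambda>z. \<Sum>t<n. (cmod (z t))\<^sup>2)" "(\<integral>z. (\<Sum>t<n. (cmod (z t))\<^sup>2) \<partial>noise n) = real n"
    by (auto simp: has_bochner_integral_iff)
qed

text \<open>Two applications of \<open>noise_moment\<close>: the inner one treats everything but the
  second noise as the constant. It evaluates the estimation error in
  \<open>neg_entropy_diff_le\<close>.\<close>

lemma pair_noise_moment:
  "has_bochner_integral (noise n \<Otimes>\<^sub>M noise n) (\<lambda>x. \<Sum>t<n. (cmod (A t + B * fst x t + C * snd x t))\<^sup>2)
     ((\<Sum>t<n. (cmod (A t))\<^sup>2) + real n * ((cmod B)\<^sup>2 + (cmod C)\<^sup>2))"
proof -
  interpret pair_prob_space "noise n" "noise n" by (rule pair_prob_space_noise)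
  have "has_bochner_integral (noise n \<Otimes>\<^sub>M noise n) (\<lambda>x. \<Sum>t<n. (cmod (A t + B * fst x t + C * snd x t))\<^sup>2)
     (\<Sum>t<n. (cmod (A t))\<^sup>2 + ((cmod B)\<^sup>2 + (cmod C)\<^sup>2))"
  proof (intro has_bochner_integral_sum has_bochner_integral_nn_integral)
    fix t assume t: "t \<in> {..<n}"
    show "(\<lambda>x. (cmod (A t + B * fst x t + C * snd x t))\<^sup>2) \<in> borel_measurable (noise n \<Otimes>\<^sub>M noise n)"
      using t by measurable
    then have "(\<integral>\<^sup>+x. ennreal ((cmod (A t + B * fst x t + C * snd x t))\<^sup>2) \<partial>(noise n \<Otimes>\<^sub>M noise n))
      = (\<integral>\<^sup>+z. (\<integral>\<^sup>+v. ennreal ((cmod ((A t + B * z t) + C * v t))\<^sup>2) \<partial>noise n) \<partial>noise n)"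
      by (subst M1.nn_integral_fst[symmetric]) auto
    also have "\<dots> = (\<integral>\<^sup>+z. ennreal ((cmod (A t + B * z t))\<^sup>2) + ennreal ((cmod C)\<^sup>2) \<partial>noise n)"
      using t by (subst noise_moment) auto
    also have "\<dots> = ennreal ((cmod (A t))\<^sup>2 + ((cmod B)\<^sup>2 + (cmod C)\<^sup>2))"
      using t by (subst nn_integral_add; simp add: noise_moment M1.emeasure_space_1 add.assoc)
    finally show "(\<integral>\<^sup>+x. ennreal ((cmod (A t + B * fst x t + C * snd x t))\<^sup>2) \<partial>(noise n \<Otimes>\<^sub>M noise n))
      = ennreal ((cmod (A t))\<^sup>2 + ((cmod B)\<^sup>2 + (cmod C)\<^sup>2))" .
  qed (auto simp: add_nonneg_nonneg)
  then show ?thesis by (simp add: sum.distrib)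
qed

text \<open>The mixture is at most the peak value \<open>1 / pi ^ n\<close>, and at least its own
  component w, whose logarithm at this point is quadratic in the noise. So the logarithm is
  dominated by a constant plus the noise energy.\<close>

lemma integrable_ln_mixture:
  assumes fin: "finite (set_pmf p)" and w: "w \<in> set_pmf p"
  shows "integrable (noise n) (\<lambda>z. ln (mixture n p u (\<lambda>t. u w t + z t)))"
proof -
  interpret prob_space "noise n" by (rule prob_space_noise)
  let ?K = "\<bar>ln (pmf p w)\<bar> + real n * ln pi"
  have lnpi: "0 \<le> ln pi" using pi_ge_two by (intro ln_ge_zero) simp
  have "integrable (noise n) (\<lambda>z. ?K + (\<Sum>t<n. (cmod (z t))\<^sup>2))"
    using integrable_sq_noise by simp
  then show ?thesis
  proof (rule Bochner_Integration.integrable_bound)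
    show "(\<lambda>z. ln (mixture n p u (\<lambda>t. u w t + z t))) \<in> borel_measurable (noise n)"
      by measurable
    show "AE z in noise n. norm (ln (mixture n p u (\<lambda>t. u w t + z t))) \<le> norm (?K + (\<Sum>t<n. (cmod (z t))\<^sup>2))"
    proof (rule AE_I2)
      fix z
      let ?m = "mixture n p u (\<lambda>t. u w t + z t)"
      have "cgauss n 1 (\<lambda>t. (\<lambda>t. u w t + z t) t - u w t) = cgauss n 1 z"
        by simp
      then have "pmf p w * cgauss n 1 z \<le> ?m"
        using mixture_ge[OF fin w, of n "\<lambda>t. u w t + z t" u] by simp
      moreover have p: "0 < pmf p w" using w by (rule pmf_positive)
      moreover have g: "0 < cgauss n 1 z" by (rule cgauss_pos) simp
      ultimately have "ln (pmf p w * cgauss n 1 z) \<le> ln ?m"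
        by (intro ln_mono) auto
      then have "ln (pmf p w) + ln (cgauss n 1 z) \<le> ln ?m"
        using p g by (simp add: ln_mult_pos)
      moreover have "ln ?m \<le> - (real n * ln pi)"
        using mixture_le[OF fin, of n u "\<lambda>t. u w t + z t"] mixture_pos[OF fin, of n u "\<lambda>t. u w t + z t"]
        by (subst (asm) ln_le_cancel_iff[symmetric]) (auto simp: ln_div ln_realpow)
      moreover have "0 \<le> (\<Sum>t<n. (cmod (z t))\<^sup>2)" "0 \<le> real n * ln pi"
        using lnpi by (auto intro: sum_nonneg)
      ultimately show "norm (ln ?m) \<le> norm (?K + (\<Sum>t<n. (cmod (z t))\<^sup>2))"
        by (simp add: ln_cgauss)
    qed
  qed
qed

section \<open>Correlated noise\<close>

lemma cgauss1_scale:
  assumes "0 < \<tau>"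
  shows "\<tau>\<^sup>2 * cgauss1 (\<tau>\<^sup>2) (of_real \<tau> * z) = cgauss1 1 z"
  using assms by (simp add: cgauss1_def norm_mult power_mult_distrib)

lemma cgauss_scale:
  assumes "0 < \<tau>"
  shows "\<tau> ^ (2 * n) * cgauss n (\<tau>\<^sup>2) (\<lambda>t. of_real \<tau> * z t) = cgauss n 1 z"
proof -
  have "\<tau> ^ (2 * n) * cgauss n (\<tau>\<^sup>2) (\<lambda>t. of_real \<tau> * z t) = (\<Prod>t<n. \<tau>\<^sup>2 * cgauss1 (\<tau>\<^sup>2) (of_real \<tau> * z t))"
    by (simp add: cgauss_def prod.distrib power_mult)
  then show ?thesis by (simp add: cgauss1_scale[OF assms] cgauss_def)
qed

text \<open>Bayes' rule for the pair of \<open>z\<close> and \<open>\<rho> z + \<tau> v\<close> with \<open>z\<close>, \<open>v\<close> independent: both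
  sides are its joint density.\<close>

lemma cgauss1_swap:
  assumes "0 < \<tau>" "(cmod \<rho>)\<^sup>2 + \<tau>\<^sup>2 = 1"
  shows "cgauss1 1 z * cgauss1 (\<tau>\<^sup>2) (s - \<rho> * z) = cgauss1 1 s * cgauss1 (\<tau>\<^sup>2) (z - cnj \<rho> * s)"
proof -
  define R where "R = Re (cnj s * (\<rho> * z))"
  have 1: "(cmod (s - \<rho> * z))\<^sup>2 = (cmod s)\<^sup>2 + (cmod \<rho>)\<^sup>2 * (cmod z)\<^sup>2 - 2 * R"
    unfolding cmod_power2 R_def by (simp add: power2_eq_square algebra_simps)
  have 2: "(cmod (z - cnj \<rho> * s))\<^sup>2 = (cmod z)\<^sup>2 + (cmod \<rho>)\<^sup>2 * (cmod s)\<^sup>2 - 2 * R"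
    unfolding cmod_power2 R_def by (simp add: power2_eq_square algebra_simps)
  have 3: "(cmod \<rho>)\<^sup>2 = 1 - \<tau>\<^sup>2" using assms by simp
  \<comment> \<open>Both sides equal \<open>((cmod z)^2 + (cmod s)^2 - 2 * R) / \<tau>^2\<close>,
    which is symmetric in z and s.\<close>
  have "(cmod z)\<^sup>2 + (cmod (s - \<rho> * z))\<^sup>2 / \<tau>\<^sup>2 = (cmod s)\<^sup>2 + (cmod (z - cnj \<rho> * s))\<^sup>2 / \<tau>\<^sup>2"
    using assms(1) unfolding 1 2 3 by (simp add: field_simps)
  then have "exp (- (cmod z)\<^sup>2) * exp (- ((cmod (s - \<rho> * z))\<^sup>2 / \<tau>\<^sup>2)) = exp (- (cmod s)\<^sup>2) * exp (- ((cmod (z - cnj \<rho> * s))\<^sup>2 / \<tau>\<^sup>2))"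
    unfolding exp_add[symmetric] by simp
  then show ?thesis by (simp add: cgauss1_def)
qed

lemma cgauss_swap:
  assumes "0 < \<tau>" "(cmod \<rho>)\<^sup>2 + \<tau>\<^sup>2 = 1"
  shows "cgauss n 1 z * cgauss n (\<tau>\<^sup>2) (\<lambda>t. s t - \<rho> * z t) = cgauss n 1 s * cgauss n (\<tau>\<^sup>2) (\<lambda>t. z t - cnj \<rho> * s t)"
  unfolding cgauss_def prod.distrib[symmetric] by (intro prod.cong refl cgauss1_swap assms)

lemma nn_integral_noise:
  assumes "F \<in> borel_measurable (lebesgue_seq n)"
  shows "(\<integral>\<^sup>+z. F z \<partial>noise n) = (\<integral>\<^sup>+z. ennreal (cgauss n 1 z) * F z \<partial>lebesgue_seq n)"
  unfolding noise_eq using assms by (simp add: nn_integral_density)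

lemma nn_integral_noise_affine:
  assumes "0 < \<tau>" and [measurable]: "F \<in> borel_measurable (lebesgue_seq n)"
  shows "(\<integral>\<^sup>+v. F (\<lambda>t\<in>{..<n}. c t + of_real \<tau> * v t) \<partial>noise n)
       = (\<integral>\<^sup>+s. ennreal (cgauss n (\<tau>\<^sup>2) (\<lambda>t. s t - c t)) * F s \<partial>lebesgue_seq n)"
proof -
  have [measurable]: "(\<lambda>z. \<lambda>t\<in>{..<n}. c t + of_real \<tau> * z t) \<in> lebesgue_seq n \<rightarrow>\<^sub>M lebesgue_seq n"
    by (rule measurable_affine_seq)
  have "ennreal (cgauss n 1 v) = ennreal (\<tau> ^ (2 * n)) * ennreal (cgauss n (\<tau>\<^sup>2) (\<lambda>t. (\<lambda>t\<in>{..<n}. c t + of_real \<tau> * v t) t - c t))" for v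
  proof -
    have "cgauss n (\<tau>\<^sup>2) (\<lambda>t. (\<lambda>t\<in>{..<n}. c t + of_real \<tau> * v t) t - c t) = cgauss n (\<tau>\<^sup>2) (\<lambda>t. of_real \<tau> * v t)"
      by (rule cgauss_cong) simp
    then show ?thesis using assms(1) by (simp add: cgauss_scale[symmetric, OF assms(1)] ennreal_mult')
  qed
  then have "(\<integral>\<^sup>+v. F (\<lambda>t\<in>{..<n}. c t + of_real \<tau> * v t) \<partial>noise n) =
    (\<integral>\<^sup>+v. ennreal (\<tau> ^ (2 * n)) * (ennreal (cgauss n (\<tau>\<^sup>2) (\<lambda>t. (\<lambda>t\<in>{..<n}. c t + of_real \<tau> * v t) t - c t)) *
      F (\<lambda>t\<in>{..<n}. c t + of_real \<tau> * v t)) \<partial>lebesgue_seq n)"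
    by (subst nn_integral_noise) (simp_all add: mult.assoc)
  also have "\<dots> = (\<integral>\<^sup>+s. ennreal (cgauss n (\<tau>\<^sup>2) (\<lambda>t. s t - c t)) * F s \<partial>lebesgue_seq n)"
    by (rule nn_integral_lebesgue_seq_affine[OF assms(1), of "\<lambda>s. ennreal (cgauss n (\<tau>\<^sup>2) (\<lambda>t. s t - c t)) * F s"]) simp
  finally show ?thesis .
qed

lemma pair_sigma_finite_lebesgue_seq: "pair_sigma_finite (lebesgue_seq n) (lebesgue_seq n)"
  by (simp add: pair_sigma_finite_def sigma_finite_lebesgue_seq)

lemma measurable_corr [measurable]:
  "(\<lambda>x. \<lambda>t\<in>{..<n}. \<rho> * fst x t + of_real \<tau> * snd x t) \<in> (noise n \<Otimes>\<^sub>M noise n) \<rightarrow>\<^sub>M lebesgue_seq n"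
proof (rule measurable_restrict)
  fix t assume t: "t \<in> {..<n}"
  then have "(\<lambda>x. \<rho> * fst x t + of_real \<tau> * snd x t) \<in> borel_measurable (noise n \<Otimes>\<^sub>M noise n)"
    by measurable
  then show "(\<lambda>x. \<rho> * fst x t + of_real \<tau> * snd x t) \<in> (noise n \<Otimes>\<^sub>M noise n) \<rightarrow>\<^sub>M lborel" by simp
qed

text \<open>Write the joint density of z and \<open>\<rho> z + \<tau> v\<close>, factor it the other
  way by \<open>cgauss_swap\<close>, exchange the integrals, and the conditional density of z
  integrates to 1. This permits coupling the noises of two destinations without changing either
  marginal.\<close>

lemma distr_correlated_noise:
  assumes \<tau>: "0 < \<tau>" "(cmod \<rho>)\<^sup>2 + \<tau>\<^sup>2 = 1"
  shows "distr (noise n \<Otimes>\<^sub>M noise n) (noise n) (\<lambda>x. \<lambda>t\<in>{..<n}. \<rho> * fst x t + of_real \<tau> * snd x t) = noise n"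
    (is "distr _ _ ?T = _")
proof (rule measure_eqI)
  interpret N: pair_prob_space "noise n" "noise n" by (rule pair_prob_space_noise)
  interpret L: pair_sigma_finite "lebesgue_seq n" "lebesgue_seq n" by (rule pair_sigma_finite_lebesgue_seq)
  have T [measurable]: "?T \<in> (noise n \<Otimes>\<^sub>M noise n) \<rightarrow>\<^sub>M noise n"
    using measurable_corr by simp
  fix A assume "A \<in> sets (distr (noise n \<Otimes>\<^sub>M noise n) (noise n) ?T)"
  then have A [measurable]: "A \<in> sets (lebesgue_seq n)" by simp
  have "emeasure (distr (noise n \<Otimes>\<^sub>M noise n) (noise n) ?T) A = (\<integral>\<^sup>+x. indicator A x \<partial>distr (noise n \<Otimes>\<^sub>M noise n) (noise n) ?T)"
    by simp
  also have "\<dots> = (\<integral>\<^sup>+x. indicator A (?T x) \<partial>(noise n \<Otimes>\<^sub>M noise n))"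
    by (subst nn_integral_distr[OF T]) auto
  also have "\<dots> = (\<integral>\<^sup>+z. \<integral>\<^sup>+v. indicator A (?T (z, v)) \<partial>noise n \<partial>noise n)"
    by (subst N.M1.nn_integral_fst[symmetric]) (use A T in auto)
  also have "\<dots> = (\<integral>\<^sup>+z. \<integral>\<^sup>+s. ennreal (cgauss n (\<tau>\<^sup>2) (\<lambda>t. s t - \<rho> * z t)) * indicator A s \<partial>lebesgue_seq n \<partial>noise n)"
    by (simp only: fst_conv snd_conv) (subst nn_integral_noise_affine[OF \<tau>(1), of "indicator A"], use A in auto)
  also have "\<dots> = (\<integral>\<^sup>+z. ennreal (cgauss n 1 z) * (\<integral>\<^sup>+s. ennreal (cgauss n (\<tau>\<^sup>2) (\<lambda>t. s t - \<rho> * z t)) * indicator A s \<partial>lebesgue_seq n) \<partial>lebesgue_seq n)"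
    by (rule nn_integral_noise) measurable
  also have "\<dots> = (\<integral>\<^sup>+z. \<integral>\<^sup>+s. ennreal (cgauss n 1 z) * (ennreal (cgauss n (\<tau>\<^sup>2) (\<lambda>t. s t - \<rho> * z t)) * indicator A s) \<partial>lebesgue_seq n \<partial>lebesgue_seq n)"
    by (intro nn_integral_cong nn_integral_cmult[symmetric]) measurable
  also have "\<dots> = (\<integral>\<^sup>+z. \<integral>\<^sup>+s. ennreal (cgauss n 1 s) * indicator A s * ennreal (cgauss n (\<tau>\<^sup>2) (\<lambda>t. z t - cnj \<rho> * s t)) \<partial>lebesgue_seq n \<partial>lebesgue_seq n)"
  proof (intro nn_integral_cong)
    fix z s :: "nat \<Rightarrow> complex"
    show "ennreal (cgauss n 1 z) * (ennreal (cgauss n (\<tau>\<^sup>2) (\<lambda>t. s t - \<rho> * z t)) * indicator A s)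
      = ennreal (cgauss n 1 s) * indicator A s * ennreal (cgauss n (\<tau>\<^sup>2) (\<lambda>t. z t - cnj \<rho> * s t))"
      using cgauss_swap[OF \<tau>, of n z s] cgauss_pos[of 1 n] cgauss_pos[of "\<tau>\<^sup>2" n] \<tau>
      by (auto simp: indicator_def ennreal_mult'[symmetric] less_imp_le)
  qed
  also have "\<dots> = (\<integral>\<^sup>+s. \<integral>\<^sup>+z. ennreal (cgauss n 1 s) * indicator A s * ennreal (cgauss n (\<tau>\<^sup>2) (\<lambda>t. z t - cnj \<rho> * s t)) \<partial>lebesgue_seq n \<partial>lebesgue_seq n)"
    by (rule L.Fubini') measurable
  also have "\<dots> = (\<integral>\<^sup>+s. ennreal (cgauss n 1 s) * indicator A s \<partial>lebesgue_seq n)"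
    using \<tau> by (subst nn_integral_cmult) (auto simp: nn_integral_cgauss_shift)
  also have "\<dots> = emeasure (noise n) A"
    unfolding noise_eq by (simp add: emeasure_density)
  finally show "emeasure (distr (noise n \<Otimes>\<^sub>M noise n) (noise n) ?T) A = emeasure (noise n) A" .
qed simp

section \<open>Difference of two output entropies\<close>

text \<open>Averaging a function of the output alone brings in the output density as a factor, which
  then cancels the same density in the denominator of a test ratio.\<close>

lemma nn_integral_noise_shift_mixture:
  assumes fin: "finite (set_pmf p)" and [measurable]: "K \<in> borel_measurable (lebesgue_seq n)"
  shows "(\<Sum>w\<in>set_pmf p. ennreal (pmf p w) * (\<integral>\<^sup>+z. K (\<lambda>t\<in>{..<n}. u w t + z t) \<partial>noise n))
       = (\<integral>\<^sup>+y. ennreal (mixture n p u y) * K y \<partial>lebesgue_seq n)"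
proof -
  have "(\<Sum>w\<in>set_pmf p. ennreal (pmf p w) * (\<integral>\<^sup>+z. K (\<lambda>t\<in>{..<n}. u w t + z t) \<partial>noise n))
     = (\<Sum>w\<in>set_pmf p. (\<integral>\<^sup>+y. ennreal (pmf p w) * ennreal (cgauss n 1 (\<lambda>t. y t - u w t)) * K y \<partial>lebesgue_seq n))"
    by (simp add: nn_integral_noise_shift nn_integral_cmult[symmetric] mult.assoc)
  also have "\<dots> = (\<integral>\<^sup>+y. (\<Sum>w\<in>set_pmf p. ennreal (pmf p w) * ennreal (cgauss n 1 (\<lambda>t. y t - u w t)) * K y) \<partial>lebesgue_seq n)"
    by (rule nn_integral_sum[symmetric]) measurable
  also have "\<dots> = (\<integral>\<^sup>+y. ennreal (mixture n p u y) * K y \<partial>lebesgue_seq n)"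
    unfolding mixture_def
    by (intro nn_integral_cong, subst sum_ennreal[symmetric])
       (auto simp: less_imp_le[OF cgauss_pos] ennreal_mult sum_distrib_right)
  finally show ?thesis .
qed

lemma integral_ln_cgauss_noise: "(\<integral>z. ln (cgauss n 1 z) \<partial>noise n) = - real n - real n * ln pi"
  and integrable_ln_cgauss_noise: "integrable (noise n) (\<lambda>z. ln (cgauss n 1 z))"
proof -
  interpret prob_space "noise n" by (rule prob_space_noise)
  show "(\<integral>z. ln (cgauss n 1 z) \<partial>noise n) = - real n - real n * ln pi"
    using integrable_sq_noise[of n] integral_sq_noise[of n] by (simp add: ln_cgauss prob_space)
  show "integrable (noise n) (\<lambda>z. ln (cgauss n 1 z))"
    using integrable_sq_noise[of n] by (simp add: ln_cgauss)
qed

text \<open>Write \<open>Y = u W + z\<close>, \<open>S = s W + \<rho> z + \<tau> v\<close>. The function \<open>G\<close> in the proof is the ratio of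
  \<open>p(S) g(Y - a S - m) p(Y | W)\<close> to \<open>p(Y) p(Y, S | W)\<close>, where \<open>g\<close> is the Gaussian density of
  variance \<open>V\<close>; it has mean 1, so \<open>ln G\<close> has mean at most 0. The shift \<open>m\<close> is there because
  the codewords need not have mean zero.\<close>

lemma neg_entropy_diff_le:
  fixes u s :: "'w \<Rightarrow> nat \<Rightarrow> complex"
  assumes fin: "finite (set_pmf p)"
    and \<tau>: "0 < \<tau>" "(cmod \<rho>)\<^sup>2 + \<tau>\<^sup>2 = 1" and V: "0 < V"
    and moment: "(\<Sum>w\<in>set_pmf p. pmf p w * (\<Sum>t<n. (cmod (u w t - a * s w t - m t))\<^sup>2))
       + real n * ((cmod (1 - a * \<rho>))\<^sup>2 + (cmod a)\<^sup>2 * \<tau>\<^sup>2) \<le> real n * V"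
  shows "neg_entropy n p s - neg_entropy n p u \<le> real n * ln (V / \<tau>\<^sup>2)"
proof -
  interpret N: pair_prob_space "noise n" "noise n" by (rule pair_prob_space_noise)
  interpret L: pair_sigma_finite "lebesgue_seq n" "lebesgue_seq n" by (rule pair_sigma_finite_lebesgue_seq)
  let ?N2 = "noise n \<Otimes>\<^sub>M noise n"
  define Y where "Y w z t = u w t + z t" for w :: 'w and z :: "nat \<Rightarrow> complex" and t
  define S where "S w x t = s w t + (\<rho> * fst x t + of_real \<tau> * snd x t)" for w :: 'w and x :: "(nat \<Rightarrow> complex) \<times> (nat \<Rightarrow> complex)" and t
  define H where "H y s' = mixture n p s s' * cgauss n V (\<lambda>t. y t - a * s' t - m t) / mixture n p u y" for y s'
  \<comment> \<open>Given Y and W the first noise is known, so S has density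
    \<open>cgauss n 1 v / \<tau> ^ (2 * n)\<close> at the realised v. Dividing by it is the factor
    p(Y | W) / p(Y, S | W).\<close>
  define G where "G w x = \<tau> ^ (2 * n) * H (Y w (fst x)) (S w x) / cgauss n 1 (snd x)" for w x
  define E where "E w x = (\<Sum>t<n. (cmod (Y w (fst x) t - a * S w x t - m t))\<^sup>2)" for w x
  have mpos: "0 < mixture n p f y" for f y by (rule mixture_pos[OF fin])
  have H_cong: "H y s' = H y' s''" if "\<And>t. t < n \<Longrightarrow> y t = y' t" "\<And>t. t < n \<Longrightarrow> s' t = s'' t" for y y' s' s''
  proof -
    have "mixture n p s s' = mixture n p s s''" "mixture n p u y = mixture n p u y'"
      using that by (auto intro!: mixture_cong)
    moreover have "cgauss n V (\<lambda>t. y t - a * s' t - m t) = cgauss n V (\<lambda>t. y' t - a * s'' t - m t)"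
      using that by (intro cgauss_cong) auto
    ultimately show ?thesis by (simp add: H_def)
  qed
  have H_nonneg: "0 \<le> H y s'" for y s'
    unfolding H_def using V
    by (intro divide_nonneg_pos mult_nonneg_nonneg mpos less_imp_le[OF mpos] less_imp_le[OF cgauss_pos])
  have H_meas [measurable]: "(\<lambda>x. H (fst x) (snd x)) \<in> borel_measurable (lebesgue_seq n \<Otimes>\<^sub>M lebesgue_seq n)"
    unfolding H_def by measurable
  have H_meas2 [measurable]: "(\<lambda>s'. H y s') \<in> borel_measurable (lebesgue_seq n)" for y
    unfolding H_def by measurable
  define K where "K y = (\<integral>\<^sup>+s'. ennreal (H y s') \<partial>lebesgue_seq n)" for y
  have K_meas [measurable]: "K \<in> borel_measurable (lebesgue_seq n)"
    unfolding K_def by (rule L.M1.borel_measurable_nn_integral) (simp add: case_prod_unfold)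
  have Y_meas [measurable]: "(\<lambda>x. Y w (fst x) t) \<in> borel_measurable ?N2" if "t < n" for w t
    unfolding Y_def using that[folded lessThan_iff] by measurable
  have S_meas [measurable]: "(\<lambda>x. S w x t) \<in> borel_measurable ?N2" if "t < n" for w t
    unfolding S_def using that[folded lessThan_iff] by measurable
  have G_meas: "G w \<in> borel_measurable ?N2" for w
    unfolding G_def H_def by measurable
  have G_pos: "0 < G w x" for w x
    using mpos V \<tau> by (simp add: G_def H_def cgauss_pos)
  \<comment> \<open>The density of v cancels the denominator of G, and the power of
    \<open>\<tau>\<close> is the Jacobian for using S as variable in place of v. The result depends
    on w and z only through the output Y.\<close>
  have inner: "(\<integral>\<^sup>+v. ennreal (G w (z, v)) \<partial>noise n) = K (\<lambda>t\<in>{..<n}. u w t + z t)" for w z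
  proof -
    have meas: "(\<lambda>v. G w (z, v)) \<in> borel_measurable (lebesgue_seq n)"
      unfolding G_def H_def Y_def S_def fst_conv snd_conv by measurable
    have "(\<integral>\<^sup>+v. ennreal (G w (z, v)) \<partial>noise n) = (\<integral>\<^sup>+v. ennreal (cgauss n 1 v) * ennreal (G w (z, v)) \<partial>lebesgue_seq n)"
      using meas by (intro nn_integral_noise) simp
    also have "\<dots> = (\<integral>\<^sup>+v. ennreal (\<tau> ^ (2 * n)) * ennreal (H (\<lambda>t\<in>{..<n}. u w t + z t) (\<lambda>t\<in>{..<n}. (s w t + \<rho> * z t) + of_real \<tau> * v t)) \<partial>lebesgue_seq n)"
    proof (intro nn_integral_cong)
      fix v :: "nat \<Rightarrow> complex"
      have "H (Y w z) (S w (z, v)) = H (\<lambda>t\<in>{..<n}. u w t + z t) (\<lambda>t\<in>{..<n}. (s w t + \<rho> * z t) + of_real \<tau> * v t)"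
        by (rule H_cong) (auto simp: Y_def S_def)
      then have "cgauss n 1 v * G w (z, v) = \<tau> ^ (2 * n) * H (\<lambda>t\<in>{..<n}. u w t + z t) (\<lambda>t\<in>{..<n}. (s w t + \<rho> * z t) + of_real \<tau> * v t)"
        using cgauss_pos[of 1 n v] by (simp add: G_def)
      then show "ennreal (cgauss n 1 v) * ennreal (G w (z, v)) = ennreal (\<tau> ^ (2 * n)) * ennreal (H (\<lambda>t\<in>{..<n}. u w t + z t) (\<lambda>t\<in>{..<n}. (s w t + \<rho> * z t) + of_real \<tau> * v t))"
        using cgauss_pos[of 1 n v] \<tau> G_pos[of w "(z, v)"] H_nonneg
        by (simp only: ennreal_mult'[symmetric] less_imp_le zero_le_power)
    qed
    also have "\<dots> = K (\<lambda>t\<in>{..<n}. u w t + z t)"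
      unfolding K_def
      by (rule nn_integral_lebesgue_seq_affine[OF \<tau>(1), of "\<lambda>s'. ennreal (H (\<lambda>t\<in>{..<n}. u w t + z t) s')"]) simp
    finally show ?thesis .
  qed
  have "(\<Sum>w\<in>set_pmf p. ennreal (pmf p w) * (\<integral>\<^sup>+x. ennreal (G w x) \<partial>?N2))
      = (\<Sum>w\<in>set_pmf p. ennreal (pmf p w) * (\<integral>\<^sup>+z. K (\<lambda>t\<in>{..<n}. u w t + z t) \<partial>noise n))"
    using G_meas by (subst N.M1.nn_integral_fst[symmetric]) (auto simp: inner)
  also have "\<dots> = (\<integral>\<^sup>+y. ennreal (mixture n p u y) * K y \<partial>lebesgue_seq n)"
    by (rule nn_integral_noise_shift_mixture[OF fin]) simp
  also have "\<dots> = (\<integral>\<^sup>+y. \<integral>\<^sup>+s'. ennreal (mixture n p s s') * ennreal (cgauss n V (\<lambda>t. y t - (a * s' t + m t))) \<partial>lebesgue_seq n \<partial>lebesgue_seq n)"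
  proof (intro nn_integral_cong)
    fix y :: "nat \<Rightarrow> complex"
    have "ennreal (mixture n p u y) * ennreal (H y s') = ennreal (mixture n p s s') * ennreal (cgauss n V (\<lambda>t. y t - (a * s' t + m t)))" for s'
      using mpos[of u y] mpos[of s s'] by (simp add: ennreal_mult'[symmetric] H_def algebra_simps)
    then show "ennreal (mixture n p u y) * K y = (\<integral>\<^sup>+s'. ennreal (mixture n p s s') * ennreal (cgauss n V (\<lambda>t. y t - (a * s' t + m t))) \<partial>lebesgue_seq n)"
      unfolding K_def by (subst nn_integral_cmult[symmetric]) auto
  qed
  \<comment> \<open>With y innermost, the Gaussian centred at \<open>a * s' + m\<close> has mass 1,
    and what remains is the mass of the density of S.\<close>
  also have "\<dots> = (\<integral>\<^sup>+s'. \<integral>\<^sup>+y. ennreal (mixture n p s s') * ennreal (cgauss n V (\<lambda>t. y t - (a * s' t + m t))) \<partial>lebesgue_seq n \<partial>lebesgue_seq n)"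
    by (rule L.Fubini'[symmetric]) measurable
  also have "\<dots> = (\<integral>\<^sup>+s'. ennreal (mixture n p s s') \<partial>lebesgue_seq n)"
    by (subst nn_integral_cmult) (auto simp: nn_integral_cgauss_shift[OF V])
  also have "\<dots> = 1" by (rule nn_integral_mixture[OF fin])
  finally have total: "(\<Sum>w\<in>set_pmf p. ennreal (pmf p w) * (\<integral>\<^sup>+x. ennreal (G w x) \<partial>?N2)) \<le> 1" by simp
  have lnG: "ln (G w x) = 2 * real n * ln \<tau> + ln (mixture n p s (S w x)) - E w x / V - real n * ln (pi * V)
      - ln (mixture n p u (Y w (fst x))) - ln (cgauss n 1 (snd x))" for w x
    using mpos[of s "S w x"] mpos[of u "Y w (fst x)"] V \<tau>
      cgauss_pos[of V n "\<lambda>t. Y w (fst x) t - a * S w x t - m t"] cgauss_pos[of 1 n "snd x"]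
    unfolding G_def H_def
    by (simp add: ln_div ln_mult ln_realpow ln_cgauss[OF V] E_def)
  have fst_int: "integrable ?N2 (\<lambda>x. f (fst x))" "(\<integral>x. f (fst x) \<partial>?N2) = (\<integral>z. f z \<partial>noise n)"
    if "integrable (noise n) f" for f :: "_ \<Rightarrow> real"
  proof -
    have "distr ?N2 (noise n) fst = noise n" by (rule N.M1.distr_pair_fst)
    then show "integrable ?N2 (\<lambda>x. f (fst x))" "(\<integral>x. f (fst x) \<partial>?N2) = (\<integral>z. f z \<partial>noise n)"
      using that integrable_distr_eq[of fst ?N2 "noise n" f] integral_distr[of fst ?N2 "noise n" f] by auto
  qed
  have snd_int: "integrable ?N2 (\<lambda>x. f (snd x))" "(\<integral>x. f (snd x) \<partial>?N2) = (\<integral>z. f z \<partial>noise n)"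
    if "integrable (noise n) f" for f :: "_ \<Rightarrow> real"
    using N.integrable_product_swap[of "\<lambda>x. f (fst x)"] N.integral_product_swap[of "\<lambda>x. f (fst x)"] fst_int[OF that]
    by (auto simp: case_prod_unfold)
  \<comment> \<open>The combination of the two noises again has the noise law, so the coupling
    leaves the entropy of S unchanged.\<close>
  have corr_int: "integrable ?N2 (\<lambda>x. f (\<lambda>t\<in>{..<n}. \<rho> * fst x t + of_real \<tau> * snd x t))"
    "(\<integral>x. f (\<lambda>t\<in>{..<n}. \<rho> * fst x t + of_real \<tau> * snd x t) \<partial>?N2) = (\<integral>z. f z \<partial>noise n)"
    if "integrable (noise n) f" for f :: "_ \<Rightarrow> real"
  proof -
    have T: "(\<lambda>x. \<lambda>t\<in>{..<n}. \<rho> * fst x t + of_real \<tau> * snd x t) \<in> ?N2 \<rightarrow>\<^sub>M noise n"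
      using measurable_corr by simp
    show "integrable ?N2 (\<lambda>x. f (\<lambda>t\<in>{..<n}. \<rho> * fst x t + of_real \<tau> * snd x t))"
      "(\<integral>x. f (\<lambda>t\<in>{..<n}. \<rho> * fst x t + of_real \<tau> * snd x t) \<partial>?N2) = (\<integral>z. f z \<partial>noise n)"
      using that integrable_distr_eq[OF T, of f] integral_distr[OF T, of f] distr_correlated_noise[OF \<tau>, of n] by auto
  qed
  have intS: "integrable ?N2 (\<lambda>x. ln (mixture n p s (S w x)))"
     "(\<integral>x. ln (mixture n p s (S w x)) \<partial>?N2) = (\<integral>z. ln (mixture n p s (\<lambda>t. s w t + z t)) \<partial>noise n)"
    if w: "w \<in> set_pmf p" for w
  proof -
    have "mixture n p s (S w x) = mixture n p s (\<lambda>t. s w t + (\<lambda>t\<in>{..<n}. \<rho> * fst x t + of_real \<tau> * snd x t) t)" for x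
      by (rule mixture_cong) (simp add: S_def)
    then show "integrable ?N2 (\<lambda>x. ln (mixture n p s (S w x)))"
     "(\<integral>x. ln (mixture n p s (S w x)) \<partial>?N2) = (\<integral>z. ln (mixture n p s (\<lambda>t. s w t + z t)) \<partial>noise n)"
      using corr_int[OF integrable_ln_mixture[OF fin w, of n s]] by simp_all
  qed
  have intY: "integrable ?N2 (\<lambda>x. ln (mixture n p u (Y w (fst x))))"
     "(\<integral>x. ln (mixture n p u (Y w (fst x))) \<partial>?N2) = (\<integral>z. ln (mixture n p u (\<lambda>t. u w t + z t)) \<partial>noise n)"
    if w: "w \<in> set_pmf p" for w
    using fst_int[OF integrable_ln_mixture[OF fin w, of n u]] by (simp_all add: Y_def[abs_def])
  have E_hbi: "has_bochner_integral ?N2 (E w) ((\<Sum>t<n. (cmod (u w t - a * s w t - m t))\<^sup>2) + real n * ((cmod (1 - a * \<rho>))\<^sup>2 + (cmod a)\<^sup>2 * \<tau>\<^sup>2))" for w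
  proof -
    have "E w x = (\<Sum>t<n. (cmod ((u w t - a * s w t - m t) + (1 - a * \<rho>) * fst x t + (- a * of_real \<tau>) * snd x t))\<^sup>2)" for x
      unfolding E_def Y_def S_def by (intro sum.cong refl arg_cong[where f="\<lambda>z. (cmod z)\<^sup>2"]) (simp add: algebra_simps)
    then have E_eq: "E w = (\<lambda>x. (\<Sum>t<n. (cmod ((u w t - a * s w t - m t) + (1 - a * \<rho>) * fst x t + (- a * of_real \<tau>) * snd x t))\<^sup>2))"
      by (rule ext)
    show ?thesis unfolding E_eq
      using pair_noise_moment[of n "\<lambda>t. u w t - a * s w t - m t" "1 - a * \<rho>" "- a * of_real \<tau>"]
      by (simp add: norm_mult power_mult_distrib)
  qed
  have intE: "integrable ?N2 (E w)" for w using E_hbi by (rule integrable.intros)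
  note int_v = snd_int[OF integrable_ln_cgauss_noise[of n]]
  have int: "integrable ?N2 (\<lambda>x. ln (G w x))" if "w \<in> set_pmf p" for w
    unfolding lnG using intS(1)[OF that] intY(1)[OF that] intE[of w] int_v(1) by simp
  \<comment> \<open>Gathers the constants of \<open>lnG\<close>. The last summand comes from the
    mean energy n of v; the \<open>ln pi\<close> from v cancels the one from the Gaussian of
    variance V.\<close>
  define c where "c = 2 * real n * ln \<tau> - real n * ln V + real n"
  define e where "e w = (\<Sum>t<n. (cmod (u w t - a * s w t - m t))\<^sup>2)" for w
  define d where "d = real n * ((cmod (1 - a * \<rho>))\<^sup>2 + (cmod a)\<^sup>2 * \<tau>\<^sup>2)"
  have val: "(\<integral>x. ln (G w x) \<partial>?N2) = c - (e w + d) / V + (\<integral>z. ln (mixture n p s (\<lambda>t. s w t + z t)) \<partial>noise n)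
     - (\<integral>z. ln (mixture n p u (\<lambda>t. u w t + z t)) \<partial>noise n)" if "w \<in> set_pmf p" for w
    unfolding lnG
    using intS[OF that] intY[OF that] intE[of w] int_v has_bochner_integral_integral_eq[OF E_hbi, of w] V
    by (simp add: N.prob_space integral_ln_cgauss_noise ln_mult c_def d_def e_def algebra_simps)
  have "(\<Sum>w\<in>set_pmf p. pmf p w * (\<integral>x. ln (G w x) \<partial>?N2)) \<le> 0"
    using N.prob_space_axioms G_meas G_pos int total by (intro sum_pmf_ennreal_integral_ln_nonpos[OF fin]) auto
  also have "(\<Sum>w\<in>set_pmf p. pmf p w * (\<integral>x. ln (G w x) \<partial>?N2))
    = (\<Sum>w\<in>set_pmf p. pmf p w * (c - d / V) - pmf p w * e w / V + pmf p w * (\<integral>z. ln (mixture n p s (\<lambda>t. s w t + z t)) \<partial>noise n)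
     - pmf p w * (\<integral>z. ln (mixture n p u (\<lambda>t. u w t + z t)) \<partial>noise n))"
    by (intro sum.cong refl) (simp add: val algebra_simps add_divide_distrib)
  also have "\<dots> = c - d / V - (\<Sum>w\<in>set_pmf p. pmf p w * e w) / V + neg_entropy n p s - neg_entropy n p u"
    by (simp add: sum.distrib sum_subtractf neg_entropy_def sum_distrib_right[symmetric] sum_pmf_eq_1[OF fin] sum_divide_distrib)
  finally have "neg_entropy n p s - neg_entropy n p u \<le> ((\<Sum>w\<in>set_pmf p. pmf p w * e w) + d) / V - c"
    by (simp add: add_divide_distrib)
  \<comment> \<open>The moment hypothesis bounds the mean squared error by n V. The resulting n
    cancels the one in c, leaving only V and \<open>\<tau>\<close>.\<close>
  also have "\<dots> \<le> real n - c"
    using moment V by (simp add: d_def e_def pos_divide_le_eq)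
  also have "\<dots> = real n * ln (V / \<tau>\<^sup>2)"
    using V \<tau> by (simp add: c_def ln_div ln_realpow algebra_simps)
  finally show ?thesis .
qed

section \<open>Fano's inequality\<close>

text \<open>With \<open>c = h $ i\<close> this is the noiseless signal at destination \<open>i\<close>, with \<open>c = row_without h i\<close>
  the interference there.\<close>

definition superpose :: "complex^3 \<Rightarrow> (3 \<Rightarrow> nat \<Rightarrow> nat \<Rightarrow> complex) \<Rightarrow> (3 \<Rightarrow> nat) \<Rightarrow> nat \<Rightarrow> complex" where
  "superpose c x w t = (\<Sum>l\<in>UNIV. c $ l * x l (w l) t)"

lemma received_eq: "received h n x i w z = (\<lambda>t\<in>{..<n}. superpose (h $ i) x w t + z t)"
  by (simp add: received_def superpose_def)

text \<open>Separates the own symbol of user i from the interference, which does not see coordinate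
  i of the messages.\<close>

lemma superpose_upd:
  "superpose (h $ i) x (w(i := v)) t = superpose (row_without h i) x w t + h $ i $ i * x i v t"
proof -
  have "(\<Sum>l\<in>UNIV. h $ i $ l * x l ((w(i := v)) l) t) = (\<Sum>l\<in>UNIV - {i}. h $ i $ l * x l (w l) t) + h $ i $ i * x i v t"
    by (subst sum.remove[of _ i]) (auto simp: add.commute)
  moreover have "(\<Sum>l\<in>UNIV. row_without h i $ l * x l (w l) t) = (\<Sum>l\<in>UNIV - {i}. h $ i $ l * x l (w l) t)"
    by (subst sum.remove[of _ i]) (auto simp: row_without_def)
  ultimately show ?thesis by (simp add: superpose_def)
qed

lemma finite_set_pmf_messages:
  assumes "\<And>i. 0 < M i"
  shows "finite (set_pmf (messages M))"
  unfolding messages_def using assms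
  by (subst set_Pi_pmf) (auto intro!: finite_PiE_dflt simp: lessThan_empty_iff)

text \<open>Overwriting one coordinate by a fresh draw preserves a product law. This expresses
  conditioning on the message of user i, and independence, while still averaging over full message
  vectors.\<close>

lemma messages_resample:
  "messages M = pmf_of_set {..<M i} \<bind> (\<lambda>v. map_pmf (\<lambda>w. w(i := v)) (messages M))"
proof -
  let ?q = "Pi_pmf (UNIV - {i}) 0 (\<lambda>i. pmf_of_set {..<M i})"
  have "messages M = Pi_pmf (insert i (UNIV - {i})) 0 (\<lambda>i. pmf_of_set {..<M i})"
    by (simp add: messages_def insert_UNIV)
  also have "\<dots> = do {v \<leftarrow> pmf_of_set {..<M i}; f \<leftarrow> ?q; return_pmf (f(i := v))}"
    by (rule Pi_pmf_insert') auto
  finally have eq: "messages M = do {v \<leftarrow> pmf_of_set {..<M i}; f \<leftarrow> ?q; return_pmf (f(i := v))}" .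
  have "map_pmf (\<lambda>w. w(i := v)) (messages M) = do {f \<leftarrow> ?q; return_pmf (f(i := v))}" for v
    by (subst eq) (simp add: map_bind_pmf map_pmf_def[symmetric] pmf.map_comp o_def bind_pmf_const)
  then show ?thesis by (simp add: eq[symmetric])
qed

lemma nn_integral_messages_resample:
  assumes "0 < M i"
  shows "(\<integral>\<^sup>+w. F w \<partial>messages M) = (\<Sum>v<M i. (\<integral>\<^sup>+w. F (w(i := v)) \<partial>messages M)) / ennreal (real (M i))"
proof -
  have "(\<integral>\<^sup>+w. F w \<partial>messages M) = (\<integral>\<^sup>+v. \<integral>\<^sup>+w. F (w(i := v)) \<partial>messages M \<partial>pmf_of_set {..<M i})"
    by (subst messages_resample[of M i]) (simp add: nn_integral_bind_pmf)
  also have "\<dots> = (\<Sum>v<M i. (\<integral>\<^sup>+w. F (w(i := v)) \<partial>messages M)) / ennreal (real (M i))"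
    using assms by (subst nn_integral_pmf_of_set) (auto simp: lessThan_empty_iff ennreal_of_nat_eq_real_of_nat)
  finally show ?thesis .
qed

lemma received_measurable [measurable]:
  "received h n x i w \<in> noise n \<rightarrow>\<^sub>M PiM {..<n} (\<lambda>_. borel)"
proof -
  have "(\<lambda>z. \<lambda>t\<in>{..<n}. superpose (h $ i) x w t + 1 * z t) \<in> lebesgue_seq n \<rightarrow>\<^sub>M lebesgue_seq n"
    by (rule measurable_affine_seq)
  moreover have "sets (lebesgue_seq n) = sets (PiM {..<n} (\<lambda>_. borel :: complex measure))"
    by (intro sets_PiM_cong) auto
  ultimately show ?thesis
    by (simp add: received_eq[abs_def] cong: measurable_cong_sets)
qed

lemma error_prob_eq:
  assumes fin: "finite (set_pmf (messages M))"
    and d [measurable]: "d i \<in> measurable (PiM {..<n} (\<lambda>_. borel)) (count_space UNIV)"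
  shows "1 - error_prob h n M x d i =
    (\<Sum>w\<in>set_pmf (messages M). pmf (messages M) w * measure (noise n) {z \<in> space (noise n). d i (received h n x i w z) = w i})"
proof -
  interpret N: prob_space "noise n" by (rule prob_space_noise)
  interpret P: pair_prob_space "measure_pmf (messages M)" "noise n" ..
  let ?P = "measure_pmf (messages M) \<Otimes>\<^sub>M noise n"
  define X where "X = {y \<in> space ?P. d i (received h n x i (fst y) (snd y)) = fst y i}"
  \<comment> \<open>The message vectors form a countable discrete space, so measurability need only
    be checked for each fixed vector.\<close>
  have "(\<lambda>y. d i (received h n x i (fst y) (snd y)) = fst y i) \<in> measurable (count_space UNIV \<Otimes>\<^sub>M noise n) (count_space UNIV)"
    by (rule measurable_pair_measure_countable1) auto
  then have "(\<lambda>y. d i (received h n x i (fst y) (snd y)) = fst y i) \<in> measurable ?P (count_space UNIV)"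
    by (simp cong: measurable_cong_sets sets_pair_measure_cong)
  then have X: "X \<in> sets ?P"
    unfolding X_def by (rule predE)
  have "{(w, z) \<in> space ?P. d i (received h n x i w z) \<noteq> w i} = space ?P - X"
    by (auto simp: X_def)
  then have "1 - error_prob h n M x d i = measure ?P X"
    unfolding error_prob_def using P.prob_compl[OF X] by simp
  also have "\<dots> = (\<Sum>w\<in>set_pmf (messages M). pmf (messages M) w * measure (noise n) {z \<in> space (noise n). d i (received h n x i w z) = w i})"
  proof -
    have "emeasure ?P X = (\<integral>\<^sup>+w. emeasure (noise n) (Pair w -` X) \<partial>messages M)"
      by (rule N.emeasure_pair_measure_alt[OF X])
    also have "\<dots> = (\<Sum>w\<in>set_pmf (messages M). emeasure (noise n) (Pair w -` X) * pmf (messages M) w)"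
      by (rule nn_integral_measure_pmf_finite[OF fin]) simp
    also have "\<dots> = (\<Sum>w\<in>set_pmf (messages M). ennreal (pmf (messages M) w * measure (noise n) {z \<in> space (noise n). d i (received h n x i w z) = w i}))"
    proof (intro sum.cong refl)
      fix w
      have "Pair w -` X = {z \<in> space (noise n). d i (received h n x i w z) = w i}"
        by (auto simp: X_def space_pair_measure)
      then show "emeasure (noise n) (Pair w -` X) * pmf (messages M) w = ennreal (pmf (messages M) w * measure (noise n) {z \<in> space (noise n). d i (received h n x i w z) = w i})"
        by (simp add: N.emeasure_eq_measure ennreal_mult mult.commute)
    qed
    also have "\<dots> = ennreal (\<Sum>w\<in>set_pmf (messages M). pmf (messages M) w * measure (noise n) {z \<in> space (noise n). d i (received h n x i w z) = w i})"
      by (rule sum_ennreal) simp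
    finally show ?thesis
      by (simp add: P.emeasure_eq_measure sum_nonneg)
  qed
  finally show ?thesis .
qed

text \<open>Donsker-Varadhan bound for the mutual information of message and output, with test function
  \<open>\<phi>\<close> equal to the number of messages where the decoder is right and to 1 elsewhere.\<close>

lemma fano:
  assumes M: "\<And>i. 0 < M i"
    and d: "d i \<in> measurable (PiM {..<n} (\<lambda>_. borel)) (count_space UNIV)"
  shows "(1 - error_prob h n M x d i) * ln (real (M i)) - ln 2
     \<le> neg_entropy n (messages M) (superpose (row_without h i) x) - neg_entropy n (messages M) (superpose (h $ i) x)"
proof -
  interpret N: prob_space "noise n" by (rule prob_space_noise)
  let ?p = "messages M"
  define s where "s = superpose (row_without h i) x"
  define u where "u = superpose (h $ i) x"
  define m where "m = real (M i)"
  have m: "1 \<le> m" using M[of i] by (simp add: m_def)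
  have fin: "finite (set_pmf ?p)" by (rule finite_set_pmf_messages) (rule M)
  define c where "c v t = h $ i $ i * x i v t" for v t
  have u_upd: "u (w(i := v)) t = s w t + c v t" for w v t
    by (simp add: u_def s_def superpose_upd c_def)
  have u_eq: "u w t = s w t + c (w i) t" for w t
    using u_upd[of w "w i"] by simp
  define \<phi> where "\<phi> v y = (if d i y = v then m else 1)" for v y
  have d' [measurable]: "d i \<in> measurable (lebesgue_seq n) (count_space UNIV)"
  proof -
    have "sets (lebesgue_seq n) = sets (PiM {..<n} (\<lambda>_. borel :: complex measure))"
      by (intro sets_PiM_cong) auto
    then show ?thesis using d by (simp cong: measurable_cong_sets)
  qed
  have \<phi>_meas [measurable]: "\<phi> v \<in> borel_measurable (lebesgue_seq n)" for v
    unfolding \<phi>_def by measurable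
  have \<phi>_pos: "0 < \<phi> v y" for v y using m by (simp add: \<phi>_def)
  \<comment> \<open>The shifted mixture is the output density given that user i sends v. The 2
    compensates for the sum of \<open>\<phi> v y\<close> over all v, which is at most 2 m; its
    logarithm is the \<open>ln 2\<close> of the conclusion.\<close>
  define K where "K v y = mixture n ?p u y * \<phi> v y / (2 * mixture n ?p s (\<lambda>t. y t - c v t))" for v y
  have mpos: "0 < mixture n ?p f y" for f y by (rule mixture_pos[OF fin])
  have K_pos: "0 < K v y" for v y
    using mpos \<phi>_pos by (simp add: K_def)
  have K_meas [measurable]: "K v \<in> borel_measurable (lebesgue_seq n)" for v
    unfolding K_def by measurable
  define R where "R w z = (\<lambda>t\<in>{..<n}. u w t + z t)" for w z
  define G where "G w z = K (w i) (R w z)" for w z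
  have R_meas [measurable]: "R w \<in> noise n \<rightarrow>\<^sub>M lebesgue_seq n" for w
    unfolding R_def using measurable_affine_seq[of "u w" 1 n] by simp
  have G_meas: "G w \<in> borel_measurable (noise n)" for w
    unfolding G_def by measurable
  have sum\<phi>: "(\<Sum>v<M i. \<phi> v y) \<le> 2 * m" for y
  proof -
    have "(\<Sum>v<M i. \<phi> v y) \<le> (\<Sum>v<M i. 1 + (if v = d i y then m else 0))"
      using m by (intro sum_mono) (auto simp: \<phi>_def)
    also have "\<dots> \<le> 2 * m" using m by (simp add: sum.distrib sum.delta m_def)
    finally show ?thesis .
  qed
  \<comment> \<open>Conditioned on the message v of user i, the output density cancels the
    denominator of \<open>K v\<close>.\<close>
  have one: "(\<integral>\<^sup>+w. (\<integral>\<^sup>+z. ennreal (G (w(i := v)) z) \<partial>noise n) \<partial>?p) = (\<integral>\<^sup>+y. ennreal (mixture n ?p u y * \<phi> v y / 2) \<partial>lebesgue_seq n)" for v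
  proof -
    have "(\<integral>\<^sup>+w. (\<integral>\<^sup>+z. ennreal (G (w(i := v)) z) \<partial>noise n) \<partial>?p)
       = (\<integral>\<^sup>+w. (\<integral>\<^sup>+z. ennreal (K v (\<lambda>t\<in>{..<n}. (s w t + c v t) + z t)) \<partial>noise n) \<partial>?p)"
      by (simp add: G_def R_def u_upd)
    also have "\<dots> = (\<Sum>w\<in>set_pmf ?p. ennreal (pmf ?p w) * (\<integral>\<^sup>+z. ennreal (K v (\<lambda>t\<in>{..<n}. (s w t + c v t) + z t)) \<partial>noise n))"
      by (subst nn_integral_measure_pmf_finite[OF fin]) (auto simp: mult.commute)
    also have "\<dots> = (\<integral>\<^sup>+y. ennreal (mixture n ?p (\<lambda>w t. s w t + c v t) y) * ennreal (K v y) \<partial>lebesgue_seq n)"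
      by (rule nn_integral_noise_shift_mixture[OF fin, where K="\<lambda>y. ennreal (K v y)" and u="\<lambda>w t. s w t + c v t"]) simp
    also have "\<dots> = (\<integral>\<^sup>+y. ennreal (mixture n ?p u y * \<phi> v y / 2) \<partial>lebesgue_seq n)"
    proof (intro nn_integral_cong)
      fix y :: "nat \<Rightarrow> complex"
      have "mixture n ?p (\<lambda>w t. s w t + c v t) y = mixture n ?p s (\<lambda>t. y t - c v t)"
        by (simp add: mixture_def algebra_simps)
      then have "mixture n ?p (\<lambda>w t. s w t + c v t) y * K v y = mixture n ?p u y * \<phi> v y / 2"
        using mpos[of s "\<lambda>t. y t - c v t"] by (simp add: K_def)
      then show "ennreal (mixture n ?p (\<lambda>w t. s w t + c v t) y) * ennreal (K v y) = ennreal (mixture n ?p u y * \<phi> v y / 2)"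
        using less_imp_le[OF mpos] by (metis ennreal_mult')
    qed
    finally show ?thesis .
  qed
  have "(\<Sum>w\<in>set_pmf ?p. ennreal (pmf ?p w) * (\<integral>\<^sup>+z. ennreal (G w z) \<partial>noise n)) = (\<integral>\<^sup>+w. (\<integral>\<^sup>+z. ennreal (G w z) \<partial>noise n) \<partial>?p)"
    by (subst nn_integral_measure_pmf_finite[OF fin]) (auto simp: mult.commute)
  also have "\<dots> = (\<Sum>v<M i. \<integral>\<^sup>+y. ennreal (mixture n ?p u y * \<phi> v y / 2) \<partial>lebesgue_seq n) / ennreal m"
    by (subst nn_integral_messages_resample[where i=i, OF M]) (simp add: one m_def)
  also have "(\<Sum>v<M i. \<integral>\<^sup>+y. ennreal (mixture n ?p u y * \<phi> v y / 2) \<partial>lebesgue_seq n)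
     = (\<integral>\<^sup>+y. (\<Sum>v<M i. ennreal (mixture n ?p u y * \<phi> v y / 2)) \<partial>lebesgue_seq n)"
    by (rule nn_integral_sum[symmetric]) measurable
  also have "\<dots> \<le> (\<integral>\<^sup>+y. ennreal m * ennreal (mixture n ?p u y) \<partial>lebesgue_seq n)"
  proof (intro nn_integral_mono)
    fix y :: "nat \<Rightarrow> complex"
    have "(\<Sum>v<M i. ennreal (mixture n ?p u y * \<phi> v y / 2)) = ennreal (\<Sum>v<M i. mixture n ?p u y * \<phi> v y / 2)"
      using mpos[of u y] \<phi>_pos by (intro sum_ennreal) (simp add: less_imp_le)
    also have "(\<Sum>v<M i. mixture n ?p u y * \<phi> v y / 2) = mixture n ?p u y * ((\<Sum>v<M i. \<phi> v y) / 2)"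
      by (simp add: sum_distrib_left sum_divide_distrib)
    also have "\<dots> \<le> mixture n ?p u y * m"
      using mpos[of u y] sum\<phi>[of y] by (intro mult_left_mono) auto
    finally show "(\<Sum>v<M i. ennreal (mixture n ?p u y * \<phi> v y / 2)) \<le> ennreal m * ennreal (mixture n ?p u y)"
      using m by (simp add: ennreal_mult'[symmetric] mult.commute ennreal_leI)
  qed
  also have "\<dots> = ennreal m"
    by (simp add: nn_integral_cmult nn_integral_mixture[OF fin])
  finally have total: "(\<Sum>w\<in>set_pmf ?p. ennreal (pmf ?p w) * (\<integral>\<^sup>+z. ennreal (G w z) \<partial>noise n)) \<le> 1"
    using m by (simp add: divide_right_mono_ennreal ennreal_divide_self)
  have lnG: "ln (G w z) = ln (mixture n ?p u (\<lambda>t. u w t + z t)) + ln m * indicator {z. d i (R w z) = w i} z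
      - ln 2 - ln (mixture n ?p s (\<lambda>t. s w t + z t))" for w z
  proof -
    have 1: "mixture n ?p u (R w z) = mixture n ?p u (\<lambda>t. u w t + z t)"
      by (rule mixture_cong) (simp add: R_def)
    have 2: "mixture n ?p s (\<lambda>t. R w z t - c (w i) t) = mixture n ?p s (\<lambda>t. s w t + z t)"
      by (rule mixture_cong) (simp add: R_def u_eq)
    show ?thesis unfolding G_def K_def 1 2
      using mpos[of u "\<lambda>t. u w t + z t"] mpos[of s "\<lambda>t. s w t + z t"] m
      by (simp add: ln_div ln_mult \<phi>_def indicator_def)
  qed
  have B: "{z \<in> space (noise n). d i (R w z) = w i} \<in> sets (noise n)" for w by measurable
  have ind: "integrable (noise n) (indicator {z. d i (R w z) = w i} :: _ \<Rightarrow> real)"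
     "(\<integral>z. indicator {z. d i (R w z) = w i} z \<partial>noise n) = measure (noise n) {z \<in> space (noise n). d i (R w z) = w i}" for w
  proof -
    have "integrable (noise n) (indicator {z \<in> space (noise n). d i (R w z) = w i} :: _ \<Rightarrow> real)"
      using B[of w] by (simp add: N.emeasure_eq_measure)
    then show "integrable (noise n) (indicator {z. d i (R w z) = w i} :: _ \<Rightarrow> real)"
      by (rule Bochner_Integration.integrable_cong[THEN iffD1, rotated -1]) (auto simp: indicator_def)
    have "(\<integral>z. indicator {z. d i (R w z) = w i} z \<partial>noise n) = (\<integral>z. indicator {z \<in> space (noise n). d i (R w z) = w i} z \<partial>noise n :: real)"
      by (rule Bochner_Integration.integral_cong) (auto simp: indicator_def)
    then show "(\<integral>z. indicator {z. d i (R w z) = w i} z \<partial>noise n) = measure (noise n) {z \<in> space (noise n). d i (R w z) = w i}"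
      using B[of w] by simp
  qed
  note int_mix = integrable_ln_mixture[OF fin, of _ n u] integrable_ln_mixture[OF fin, of _ n s]
  have int: "integrable (noise n) (\<lambda>z. ln (G w z))" if "w \<in> set_pmf ?p" for w
    unfolding lnG using int_mix[OF that] ind(1)[of w] by simp
  define P where "P w = measure (noise n) {z \<in> space (noise n). d i (R w z) = w i}" for w
  have val: "(\<integral>z. ln (G w z) \<partial>noise n) = (\<integral>z. ln (mixture n ?p u (\<lambda>t. u w t + z t)) \<partial>noise n) + ln m * P w - ln 2
     - (\<integral>z. ln (mixture n ?p s (\<lambda>t. s w t + z t)) \<partial>noise n)" if "w \<in> set_pmf ?p" for w
    unfolding lnG using int_mix[OF that] ind[of w] by (simp add: N.prob_space P_def)
  have "(\<Sum>w\<in>set_pmf ?p. pmf ?p w * (\<integral>z. ln (G w z) \<partial>noise n)) \<le> 0"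
    using prob_space_noise G_meas K_pos int total
    by (intro sum_pmf_ennreal_integral_ln_nonpos[OF fin]) (auto simp: G_def)
  also have "(\<Sum>w\<in>set_pmf ?p. pmf ?p w * (\<integral>z. ln (G w z) \<partial>noise n)) =
    (\<Sum>w\<in>set_pmf ?p. pmf ?p w * (\<integral>z. ln (mixture n ?p u (\<lambda>t. u w t + z t)) \<partial>noise n) + ln m * (pmf ?p w * P w) - ln 2 * pmf ?p w
      - pmf ?p w * (\<integral>z. ln (mixture n ?p s (\<lambda>t. s w t + z t)) \<partial>noise n))"
    by (intro sum.cong refl) (simp add: val algebra_simps)
  also have "\<dots> = neg_entropy n ?p u + ln m * (\<Sum>w\<in>set_pmf ?p. pmf ?p w * P w) - ln 2 - neg_entropy n ?p s"
    by (simp add: sum.distrib sum_subtractf neg_entropy_def sum_distrib_left[symmetric] sum_pmf_eq_1[OF fin])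
  also have "(\<Sum>w\<in>set_pmf ?p. pmf ?p w * P w) = 1 - error_prob h n M x d i"
    unfolding error_prob_eq[where d=d, OF fin d] P_def by (simp add: received_eq R_def u_def)
  finally show ?thesis by (simp add: u_def s_def m_def mult.commute)
qed

section \<open>Power constraint\<close>

lemma expectation_messages_resample:
  fixes F :: "(3 \<Rightarrow> nat) \<Rightarrow> complex"
  assumes "\<And>i. 0 < M i"
  shows "measure_pmf.expectation (messages M) F
       = (\<Sum>v<M i. measure_pmf.expectation (messages M) (\<lambda>w. F (w(i := v))) /\<^sub>R real (M i))"
proof -
  have fin: "finite (set_pmf (messages M))" by (rule finite_set_pmf_messages) (rule assms)
  show ?thesis
    by (subst messages_resample[of M i], subst pmf_expectation_bind_pmf_of_set)
       (use assms[of i] fin in \<open>auto simp: lessThan_empty_iff\<close>)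
qed

text \<open>Resampling coordinate l turns \<open>f (w l)\<close> into the constant
  \<open>f v\<close> and leaves \<open>w k\<close> alone, so the second factor comes out of the
  average over v.\<close>

lemma expectation_messages_indep:
  fixes f g :: "nat \<Rightarrow> complex"
  assumes "\<And>i. 0 < M i" "l \<noteq> k"
  shows "measure_pmf.expectation (messages M) (\<lambda>w. f (w l) * g (w k))
       = measure_pmf.expectation (messages M) (\<lambda>w. f (w l)) * measure_pmf.expectation (messages M) (\<lambda>w. g (w k))"
  using assms(2)
  by (subst (1 2) expectation_messages_resample[where i = l, OF assms(1)])
     (simp add: sum_distrib_right scaleR_conv_of_real mult.assoc)

lemma expectation_centered_sq_le:
  fixes f :: "'w \<Rightarrow> complex"
  assumes fin: "finite (set_pmf p)"
  shows "measure_pmf.expectation p (\<lambda>w. (cmod (f w - measure_pmf.expectation p f))\<^sup>2)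
       \<le> measure_pmf.expectation p (\<lambda>w. (cmod (f w))\<^sup>2)"
proof -
  define \<mu> where "\<mu> = measure_pmf.expectation p f"
  note [simp] = integrable_measure_pmf_finite[OF fin]
  have "measure_pmf.expectation p (\<lambda>w. Re (f w * cnj \<mu>)) = Re (measure_pmf.expectation p (\<lambda>w. f w * cnj \<mu>))"
    by (subst integral_Re) auto
  also have "\<dots> = (cmod \<mu>)\<^sup>2"
    unfolding cmod_power2 by (simp add: \<mu>_def[symmetric] power2_eq_square)
  finally have 1: "measure_pmf.expectation p (\<lambda>w. Re (f w * cnj \<mu>)) = (cmod \<mu>)\<^sup>2" .
  have "(cmod (f w - \<mu>))\<^sup>2 = (cmod (f w))\<^sup>2 + (cmod \<mu>)\<^sup>2 - 2 * Re (f w * cnj \<mu>)" for w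
    unfolding cmod_power2 by (simp add: power2_eq_square algebra_simps)
  then have "measure_pmf.expectation p (\<lambda>w. (cmod (f w - \<mu>))\<^sup>2) = measure_pmf.expectation p (\<lambda>w. (cmod (f w))\<^sup>2) - (cmod \<mu>)\<^sup>2"
    by (simp only: Bochner_Integration.integral_add Bochner_Integration.integral_diff integrable_measure_pmf_finite[OF fin]
        integral_mult_right 1 Bochner_Integration.integral_mult_right_zero) simp
  then show ?thesis by (simp add: \<mu>_def)
qed

text \<open>Centred signals of different users are uncorrelated, so their variances add, and
  centring does not increase power. Without centring the cross terms between users would
  survive.\<close>

lemma superpose_variance_le:
  fixes x :: "3 \<Rightarrow> nat \<Rightarrow> nat \<Rightarrow> complex" and \<alpha> :: "complex^3"
  assumes M: "\<And>i. 0 < M i"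
    and power: "\<And>i. measure_pmf.expectation (messages M) (\<lambda>w. (\<Sum>t<n. (cmod (x i (w i) t))\<^sup>2) / real n) \<le> 1"
  shows "measure_pmf.expectation (messages M) (\<lambda>w. \<Sum>t<n.
           (cmod (superpose \<alpha> x w t - measure_pmf.expectation (messages M) (\<lambda>w. superpose \<alpha> x w t)))\<^sup>2)
         \<le> real n * (norm \<alpha>)\<^sup>2"
proof -
  let ?E = "measure_pmf.expectation (messages M) :: ((3 \<Rightarrow> nat) \<Rightarrow> real) \<Rightarrow> real"
  let ?C = "measure_pmf.expectation (messages M) :: ((3 \<Rightarrow> nat) \<Rightarrow> complex) \<Rightarrow> complex"
  have fin: "finite (set_pmf (messages M))" by (rule finite_set_pmf_messages) (rule M)
  note [simp] = integrable_measure_pmf_finite[OF fin]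
  have each: "?E (\<lambda>w. (cmod (superpose \<alpha> x w t - ?C (\<lambda>w. superpose \<alpha> x w t)))\<^sup>2)
     \<le> (\<Sum>l\<in>UNIV. (cmod (\<alpha> $ l))\<^sup>2 * ?E (\<lambda>w. (cmod (x l (w l) t))\<^sup>2))" for t
  proof -
    define \<mu> where "\<mu> l = ?C (\<lambda>w. x l (w l) t)" for l
    define \<xi> where "\<xi> l v = x l v t - \<mu> l" for l v
    have c0: "?C (\<lambda>w. \<xi> l (w l)) = 0" for l
      by (simp add: \<xi>_def \<mu>_def)
    have eq: "superpose \<alpha> x w t - ?C (\<lambda>w. superpose \<alpha> x w t) = (\<Sum>l\<in>UNIV. \<alpha> $ l * \<xi> l (w l))" for w
      by (simp add: superpose_def \<xi>_def \<mu>_def sum_subtractf algebra_simps)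
    have sq: "of_real ((cmod (\<Sum>l\<in>UNIV. \<alpha> $ l * \<xi> l (w l)))\<^sup>2)
       = (\<Sum>l\<in>UNIV. \<Sum>k\<in>UNIV. \<alpha> $ l * cnj (\<alpha> $ k) * (\<xi> l (w l) * cnj (\<xi> k (w k))))" for w
      by (simp only: complex_norm_square cnj_sum sum_product) (simp add: mult_ac)
    have cross: "?C (\<lambda>w. \<xi> l (w l) * cnj (\<xi> k (w k))) = (if l = k then of_real (?E (\<lambda>w. (cmod (\<xi> l (w l)))\<^sup>2)) else 0)" for l k
    proof (cases "l = k")
      case True
      have "?C (\<lambda>w. \<xi> l (w l) * cnj (\<xi> l (w l))) = ?C (\<lambda>w. of_real ((cmod (\<xi> l (w l)))\<^sup>2))"
        by (simp only: complex_norm_square)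
      then show ?thesis using True by (simp only: integral_complex_of_real simp_thms if_True)
    next
      case False
      then show ?thesis
        using expectation_messages_indep[where M=M and f="\<xi> l" and g="\<lambda>v. cnj (\<xi> k v)", OF M False] by (simp add: c0)
    qed
    have "of_real (?E (\<lambda>w. (cmod (\<Sum>l\<in>UNIV. \<alpha> $ l * \<xi> l (w l)))\<^sup>2))
        = ?C (\<lambda>w. \<Sum>l\<in>UNIV. \<Sum>k\<in>UNIV. \<alpha> $ l * cnj (\<alpha> $ k) * (\<xi> l (w l) * cnj (\<xi> k (w k))))"
      by (simp only: sq[symmetric] integral_complex_of_real)
    also have "\<dots> = (\<Sum>l\<in>UNIV. \<Sum>k\<in>UNIV. \<alpha> $ l * cnj (\<alpha> $ k) * ?C (\<lambda>w. \<xi> l (w l) * cnj (\<xi> k (w k))))"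
      by (subst Bochner_Integration.integral_sum, simp, subst Bochner_Integration.integral_sum) simp_all
    also have "\<dots> = (\<Sum>l\<in>UNIV. \<alpha> $ l * cnj (\<alpha> $ l) * of_real (?E (\<lambda>w. (cmod (\<xi> l (w l)))\<^sup>2)))"
      by (simp add: cross if_distrib[where f="\<lambda>y. _ * y"] sum.delta cong: if_cong)
    also have "\<dots> = of_real (\<Sum>l\<in>UNIV. (cmod (\<alpha> $ l))\<^sup>2 * ?E (\<lambda>w. (cmod (\<xi> l (w l)))\<^sup>2))"
      by (simp add: complex_norm_square[symmetric])
    finally have "?E (\<lambda>w. (cmod (\<Sum>l\<in>UNIV. \<alpha> $ l * \<xi> l (w l)))\<^sup>2) = (\<Sum>l\<in>UNIV. (cmod (\<alpha> $ l))\<^sup>2 * ?E (\<lambda>w. (cmod (\<xi> l (w l)))\<^sup>2))"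
      by (simp only: of_real_eq_iff)
    also have "\<dots> \<le> (\<Sum>l\<in>UNIV. (cmod (\<alpha> $ l))\<^sup>2 * ?E (\<lambda>w. (cmod (x l (w l) t))\<^sup>2))"
      unfolding \<xi>_def \<mu>_def by (intro sum_mono mult_left_mono expectation_centered_sq_le[OF fin]) auto
    finally show ?thesis unfolding eq .
  qed
  have P: "(\<Sum>t<n. ?E (\<lambda>w. (cmod (x l (w l) t))\<^sup>2)) \<le> real n" for l
  \<comment> \<open>For n = 0 the power constraint contains a division by zero and carries no
    information, but the sum is empty.\<close>
  proof (cases "n = 0")
    case False
    then show ?thesis using power[of l] by (simp add: field_simps)
  qed simp
  have "?E (\<lambda>w. \<Sum>t<n. (cmod (superpose \<alpha> x w t - ?C (\<lambda>w. superpose \<alpha> x w t)))\<^sup>2)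
     = (\<Sum>t<n. ?E (\<lambda>w. (cmod (superpose \<alpha> x w t - ?C (\<lambda>w. superpose \<alpha> x w t)))\<^sup>2))"
    by simp
  also have "\<dots> \<le> (\<Sum>t<n. \<Sum>l\<in>UNIV. (cmod (\<alpha> $ l))\<^sup>2 * ?E (\<lambda>w. (cmod (x l (w l) t))\<^sup>2))"
    by (intro sum_mono each)
  also have "\<dots> = (\<Sum>l\<in>UNIV. (cmod (\<alpha> $ l))\<^sup>2 * (\<Sum>t<n. ?E (\<lambda>w. (cmod (x l (w l) t))\<^sup>2)))"
    by (subst sum.swap) (simp add: sum_distrib_left)
  also have "\<dots> \<le> (\<Sum>l\<in>UNIV. (cmod (\<alpha> $ l))\<^sup>2 * real n)"
    by (intro sum_mono mult_left_mono P) auto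
  also have "\<dots> = real n * (norm \<alpha>)\<^sup>2"
    by (simp add: norm_vec_def L2_set_def sum_nonneg sum_distrib_left mult.commute)
  finally show ?thesis .
qed

section \<open>Optimising the noise correlation\<close>

text \<open>The conditional variance of the Gaussian \<open>Y\<close> given \<open>S\<close>, divided by that of the second noise
  given the first, when the noises have correlation coefficient of modulus \<open>r\<close> and optimal phase;
  \<open>A\<close>, \<open>B\<close> are the signal powers and \<open>C\<close> is the modulus of the signal correlation.\<close>

definition correlated_bound :: "real \<Rightarrow> real \<Rightarrow> real \<Rightarrow> real \<Rightarrow> real" where
  "correlated_bound A B C r = (1 + A - (C + r)\<^sup>2 / (1 + B)) / (1 - r\<^sup>2)"

section \<open>Cauchy-Schwarz for the channel rows\<close>

lemma norm_sq_vec: "(norm (u :: complex^3))\<^sup>2 = (\<Sum>l\<in>UNIV. (cmod (u $ l))\<^sup>2)"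
  by (simp add: norm_vec_def L2_set_def sum_nonneg)

lemma row_times_adjoint_cauchy_schwarz: "(cmod (row_times_adjoint u v))\<^sup>2 \<le> (norm u)\<^sup>2 * (norm v)\<^sup>2"
proof -
  have "cmod (row_times_adjoint u v) \<le> (\<Sum>l\<in>UNIV. \<bar>cmod (u $ l)\<bar> * \<bar>cmod (v $ l)\<bar>)"
    unfolding row_times_adjoint_def by (rule sum_norm_le) (simp add: norm_mult)
  also have "\<dots> \<le> L2_set (\<lambda>l. cmod (u $ l)) UNIV * L2_set (\<lambda>l. cmod (v $ l)) UNIV"
    by (rule L2_set_mult_ineq)
  also have "\<dots> = norm u * norm v" by (simp add: norm_vec_def)
  finally show ?thesis by (simp add: power_mult_distrib[symmetric] power_mono)
qed

lemma norm_diff_scaled_sq: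
  "(norm (u - a *s v))\<^sup>2 = (norm u)\<^sup>2 + (cmod a)\<^sup>2 * (norm v)\<^sup>2 - 2 * Re (cnj a * row_times_adjoint u v)"
proof -
  have "(cmod (u $ l - a * v $ l))\<^sup>2 = (cmod (u $ l))\<^sup>2 + (cmod a)\<^sup>2 * (cmod (v $ l))\<^sup>2 - 2 * Re (cnj a * (u $ l * cnj (v $ l)))" for l
    unfolding cmod_power2 by (simp add: power2_eq_square algebra_simps)
  then show ?thesis
    by (simp add: norm_sq_vec row_times_adjoint_def sum.distrib sum_subtractf sum_distrib_left)
qed

lemma two_mult_le_add:
  fixes A B C :: real
  assumes "0 \<le> A" "0 \<le> B" "0 \<le> C" "C\<^sup>2 \<le> A * B"
  shows "2 * C \<le> A + B"
proof (rule power2_le_imp_le)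
  have "(A + B)\<^sup>2 = (A - B)\<^sup>2 + 4 * (A * B)" by (simp add: power2_eq_square algebra_simps)
  moreover have "0 \<le> (A - B)\<^sup>2" by simp
  moreover have "(2 * C)\<^sup>2 = 4 * C\<^sup>2" by (simp add: power_mult_distrib)
  ultimately show "(2 * C)\<^sup>2 \<le> (A + B)\<^sup>2" using assms(4) by linarith
qed (use assms in auto)

text \<open>Cauchy-Schwarz for vectors enlarged by one coordinate 1. It gives both the positivity of
  the estimation error for r < 1 and q >= 1.\<close>

lemma sq_one_plus_le_mult:
  fixes A B C :: real
  assumes "0 \<le> A" "0 \<le> B" "0 \<le> C" "C\<^sup>2 \<le> A * B"
  shows "(1 + C)\<^sup>2 \<le> (1 + A) * (1 + B)"
  using two_mult_le_add[OF assms] assms(4) by (simp add: power2_eq_square algebra_simps)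

lemma neg_entropy_diff_le_correlated_bound:
  assumes M: "\<And>i. 0 < M i"
    and power: "\<And>i. measure_pmf.expectation (messages M) (\<lambda>w. (\<Sum>t<n. (cmod (x i (w i) t))\<^sup>2) / real n) \<le> 1"
    and r: "0 \<le> r" "r < 1"
  shows "neg_entropy n (messages M) (superpose v x) - neg_entropy n (messages M) (superpose u x)
     \<le> real n * ln (correlated_bound ((norm u)\<^sup>2) ((norm v)\<^sup>2) (cmod (row_times_adjoint u v)) r)"
proof -
  let ?p = "messages M"
  have fin: "finite (set_pmf ?p)" by (rule finite_set_pmf_messages) (rule M)
  define c where "c = row_times_adjoint u v"
  define A B where "A = (norm u)\<^sup>2" and "B = (norm v)\<^sup>2"
  \<comment> \<open>The phase of the signal correlation; any unit number would do when there is
    none.\<close>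
  define e where "e = (if c = 0 then 1 else sgn c)"
  have e: "cmod e = 1" "of_real (cmod c) * e = c"
    by (simp_all add: e_def norm_sgn) (simp add: sgn_eq)
  define \<rho> where "\<rho> = of_real r * cnj e"
  define \<tau> where "\<tau> = sqrt (1 - r\<^sup>2)"
  have r2: "r\<^sup>2 < 1" using r by (simp add: power_less_one_iff)
  have \<tau>2: "\<tau>\<^sup>2 = 1 - r\<^sup>2" using r2 by (simp add: \<tau>_def)
  have \<tau>: "0 < \<tau>" using r2 by (simp add: \<tau>_def)
  have \<rho>: "cmod \<rho> = r" using r by (simp add: \<rho>_def norm_mult e)
  have B: "0 \<le> B" and A: "0 \<le> A" by (simp_all add: A_def B_def)
  \<comment> \<open>The covariance per symbol of Y and S for uncorrelated inputs of unit power: the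
    noise part is the mean of z times the conjugate of \<open>\<rho> z + \<tau> v\<close>. The
    choice of \<open>\<rho>\<close> gives both summands the phase e, which maximises the modulus for
    given r.\<close>
  define g where "g = c + cnj \<rho>"
  have g: "cmod g = cmod c + r"
  proof -
    have "g = of_real (cmod c + r) * e" by (simp add: g_def \<rho>_def distrib_right e)
    then have "cmod g = \<bar>cmod c + r\<bar> * cmod e" by (simp only: norm_mult norm_of_real)
    then show ?thesis using r by (simp add: e)
  qed
  \<comment> \<open>The optimal linear coefficient for estimating Y from S, covariance over the
    variance 1 + B of S. The V below is the resulting mean squared error.\<close>
  define a where "a = g / of_real (1 + B)"
  define V where "V = 1 + A - (cmod c + r)\<^sup>2 / (1 + B)"
  have V: "0 < V"
  proof -
    have "(cmod c + r)\<^sup>2 < (1 + cmod c)\<^sup>2" using r by (intro power_strict_mono) auto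
    also have "\<dots> \<le> (1 + A) * (1 + B)"
      unfolding A_def B_def using row_times_adjoint_cauchy_schwarz[of u v]
      by (intro sq_one_plus_le_mult) (auto simp: c_def)
    finally show ?thesis using B by (simp add: V_def pos_divide_less_eq)
  qed
  have quad: "(norm (u - a *s v))\<^sup>2 + ((cmod (1 - a * \<rho>))\<^sup>2 + (cmod a)\<^sup>2 * \<tau>\<^sup>2) = V"
  proof -
    have 1: "(cmod (1 - a * \<rho>))\<^sup>2 = 1 + (cmod a)\<^sup>2 * r\<^sup>2 - 2 * Re (cnj a * cnj \<rho>)"
      unfolding \<rho>[symmetric] cmod_power2 by (simp add: power2_eq_square algebra_simps)
    have "cnj a * g = of_real ((cmod g)\<^sup>2 / (1 + B))"
      using complex_norm_square[of g] by (simp add: a_def mult.commute)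
    then have "Re (cnj a * g) = (cmod g)\<^sup>2 / (1 + B)" by (simp only: Re_complex_of_real)
    then have 2: "Re (cnj a * c) + Re (cnj a * cnj \<rho>) = (cmod g)\<^sup>2 / (1 + B)"
      by (simp add: g_def algebra_simps)
    have "cmod a = cmod g / (1 + B)"
      using B by (simp only: a_def norm_divide norm_of_real)
    then have "(cmod a)\<^sup>2 * (1 + B) = (cmod g)\<^sup>2 / (1 + B)"
      using B by (simp add: power_divide power2_eq_square)
    then have 3: "(cmod a)\<^sup>2 * B + (cmod a)\<^sup>2 = (cmod g)\<^sup>2 / (1 + B)" by (simp add: algebra_simps)
    have 4: "(norm (u - a *s v))\<^sup>2 = A + (cmod a)\<^sup>2 * B - 2 * Re (cnj a * c)"
      by (simp only: norm_diff_scaled_sq A_def B_def c_def)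
    have 5: "(cmod a)\<^sup>2 * \<tau>\<^sup>2 = (cmod a)\<^sup>2 - (cmod a)\<^sup>2 * r\<^sup>2" by (simp add: \<tau>2 algebra_simps)
    show ?thesis
      using 2 3 unfolding 1 4 5 V_def g[symmetric] by linarith
  qed
  define m where "m t = measure_pmf.expectation ?p (\<lambda>w. superpose (u - a *s v) x w t)" for t
  have sup: "superpose u x w t - a * superpose v x w t = superpose (u - a *s v) x w t" for w t
    by (simp add: superpose_def sum_subtractf algebra_simps sum_distrib_left)
  have "(\<Sum>w\<in>set_pmf ?p. pmf ?p w * (\<Sum>t<n. (cmod (superpose u x w t - a * superpose v x w t - m t))\<^sup>2))
     = measure_pmf.expectation ?p (\<lambda>w. \<Sum>t<n. (cmod (superpose (u - a *s v) x w t - m t))\<^sup>2)"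
    unfolding sup by (subst integral_measure_pmf_real[OF fin]) (auto simp: mult.commute)
  also have "\<dots> \<le> real n * (norm (u - a *s v))\<^sup>2"
    unfolding m_def by (rule superpose_variance_le) (rule M, rule power)
  finally have "(\<Sum>w\<in>set_pmf ?p. pmf ?p w * (\<Sum>t<n. (cmod (superpose u x w t - a * superpose v x w t - m t))\<^sup>2))
    + real n * ((cmod (1 - a * \<rho>))\<^sup>2 + (cmod a)\<^sup>2 * \<tau>\<^sup>2) \<le> real n * V"
    unfolding quad[symmetric] by (simp add: algebra_simps)
  then have "neg_entropy n ?p (superpose v x) - neg_entropy n ?p (superpose u x) \<le> real n * ln (V / \<tau>\<^sup>2)"
    using \<tau> \<tau>2 \<rho> V by (intro neg_entropy_diff_le[OF fin, where \<rho>=\<rho> and a=a and m=m]) auto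
  then show ?thesis
    by (simp add: correlated_bound_def V_def \<tau>2 A_def B_def c_def)
qed

text \<open>The roots of r + 1/r = 2 q have product 1, so for q > 1 exactly one of them, the one
  taken here, lies below 1; its inverse is \<open>q + sqrt (q^2 - 1)\<close>.\<close>

lemma correlated_bound_optimum:
  fixes A B C q r :: real
  assumes "0 < C" "0 \<le> B" "1 < q" and q: "2 * C * q = (1 + A) * (1 + B) - C\<^sup>2 - 1"
    and r: "r = q - sqrt (q\<^sup>2 - 1)"
  shows "0 < r" "r < 1" "correlated_bound A B C r = (1 + C * (q + sqrt (q\<^sup>2 - 1))) / (1 + B)"
proof -
  define s where "s = sqrt (q\<^sup>2 - 1)"
  have q2: "1 < q\<^sup>2" using assms(3) by (simp add: one_less_power)
  have s2: "s\<^sup>2 = q\<^sup>2 - 1" and s: "0 < s" using q2 by (simp_all add: s_def)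
  have prod: "r * (q + s) = 1"
    using s2 unfolding r s_def[symmetric] by (simp add: power2_eq_square algebra_simps)
  have qs: "1 < q + s" using assms(3) s by simp
  have r': "r = 1 / (q + s)" using prod qs by (simp add: field_simps)
  show r0: "0 < r" and r1: "r < 1" using qs by (simp_all add: r')
  have r2: "r\<^sup>2 < 1" using r0 r1 by (simp add: power_less_one_iff)
  have rq: "r\<^sup>2 + 1 = 2 * q * r"
  proof -
    have "r\<^sup>2 + 1 = r * r + r * (q + s)" by (simp add: prod power2_eq_square)
    also have "\<dots> = r * (r + (q + s))" by (simp add: algebra_simps)
    also have "r + (q + s) = 2 * q" by (simp add: r s_def)
    finally show ?thesis by (simp add: mult.commute)
  qed
  have inv: "q + s = 1 / r" using prod r0 by (simp add: field_simps)
  \<comment> \<open>The vanishing of the derivative of \<open>correlated_bound\<close> in r, with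
    denominators cleared. It replaces the quotient by (r + C) / r = 1 + C / r.\<close>
  have "r * ((1 + A) * (1 + B) - (C + r)\<^sup>2) = (r + C) * (1 - r\<^sup>2)"
  proof -
    have "r * ((1 + A) * (1 + B) - (C + r)\<^sup>2) = r * (2 * C * q + C\<^sup>2 + 1 - (C + r)\<^sup>2)" using q by simp
    also have "\<dots> = C * (2 * q * r) + r * (1 - 2 * C * r - r\<^sup>2)" by (simp add: power2_eq_square algebra_simps)
    also have "\<dots> = (r + C) * (1 - r\<^sup>2)" unfolding rq[symmetric] by (simp add: power2_eq_square algebra_simps)
    finally show ?thesis .
  qed
  then have "((1 + A) * (1 + B) - (C + r)\<^sup>2) / (1 - r\<^sup>2) = 1 + C * (q + s)"
    using r0 r2 unfolding inv by (simp add: field_simps)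
  moreover have "correlated_bound A B C r = ((1 + A) * (1 + B) - (C + r)\<^sup>2) / (1 - r\<^sup>2) / (1 + B)"
    using assms(2) r2 by (simp add: correlated_bound_def field_simps)
  ultimately show "correlated_bound A B C r = (1 + C * (q + sqrt (q\<^sup>2 - 1))) / (1 + B)"
    by (simp add: s_def)
qed

text \<open>For \<open>q = 1\<close> the optimal correlation is 1, where \<open>correlated_bound\<close> is 0/0.\<close>

lemma correlated_bound_limit:
  fixes A B C :: real
  assumes "0 \<le> B" "0 < C" and q: "2 * C = (1 + A) * (1 + B) - C\<^sup>2 - 1"
  shows "((\<lambda>r. correlated_bound A B C r) \<longlongrightarrow> (1 + C) / (1 + B)) (at_left 1)"
proof (rule Lim_transform_eventually)
  have "((\<lambda>r. (1 + 2 * C + r) / ((1 + r) * (1 + B))) \<longlongrightarrow> (1 + 2 * C + 1) / ((1 + 1) * (1 + B))) (at_left 1)"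
    using assms(1) by (intro tendsto_intros) auto
  moreover have "(1 + 2 * C + 1) / ((1 + 1) * (1 + B)) = (1 + C) / (1 + B)"
    using assms(1) by (simp add: field_simps)
  ultimately show "((\<lambda>r. (1 + 2 * C + r) / ((1 + r) * (1 + B))) \<longlongrightarrow> (1 + C) / (1 + B)) (at_left 1)" by simp
  show "eventually (\<lambda>r. (1 + 2 * C + r) / ((1 + r) * (1 + B)) = correlated_bound A B C r) (at_left 1)"
    using eventually_at_left_real[OF zero_less_one]
  proof (eventually_elim)
    fix r :: real assume r: "r \<in> {0<..<1}"
    \<comment> \<open>q = 1 is the equality case of \<open>sq_one_plus_le_mult\<close>; it makes the
      numerator divisible by 1 - r, which removes the singularity.\<close>
    have "1 + A = ((1 + C)\<^sup>2) / (1 + B)"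
      using q assms(1) by (simp add: field_simps power2_eq_square)
    then have "correlated_bound A B C r = (((1 + C)\<^sup>2 - (C + r)\<^sup>2) / (1 + B)) / (1 - r\<^sup>2)"
      by (simp add: correlated_bound_def diff_divide_distrib)
    also have "(1 + C)\<^sup>2 - (C + r)\<^sup>2 = (1 - r) * (1 + 2 * C + r)" by (simp add: power2_eq_square algebra_simps)
    also have "1 - r\<^sup>2 = (1 - r) * (1 + r)" by (simp add: power2_eq_square algebra_simps)
    also have "(1 - r) * (1 + 2 * C + r) / (1 + B) / ((1 - r) * (1 + r)) = (1 + 2 * C + r) / ((1 + r) * (1 + B))"
      using r assms(1) by (simp add: divide_simps)
    finally show "(1 + 2 * C + r) / ((1 + r) * (1 + B)) = correlated_bound A B C r" by simp
  qed
qed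

text \<open>After clearing the positive denominator the claim is \<open>sq_one_plus_le_mult\<close>
  for these norms.\<close>

lemma q_term_ge_1:
  assumes "corr h j k \<noteq> 0"
  shows "1 \<le> q_term h j k"
proof -
  let ?A = "(norm (h $ j))\<^sup>2" and ?B = "(norm (row_without h k))\<^sup>2" and ?C = "cmod (corr h j k)"
  have "(1 + ?C)\<^sup>2 \<le> (1 + ?A) * (1 + ?B)"
    using row_times_adjoint_cauchy_schwarz[of "h $ j" "row_without h k"]
    by (intro sq_one_plus_le_mult) (auto simp: corr_def)
  then show ?thesis
    using assms by (simp add: q_term_def pos_le_divide_eq power2_sum)
qed

text \<open>The bound is assumed for all r < 1 because the best r depends on the case: r = 0 if the
  signals are uncorrelated, the limit r -> 1 if q = 1, and the stationary point otherwise. The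
  factor \<open>ln b\<close> converts nats to base b.\<close>

lemma le_f_term:
  assumes "1 < b"
    and le: "\<And>r. 0 \<le> r \<Longrightarrow> r < 1 \<Longrightarrow>
       X \<le> real n * ln (correlated_bound ((norm (h $ j))\<^sup>2) ((norm (row_without h k))\<^sup>2) (cmod (corr h j k)) r)"
  shows "X \<le> real n * (ln b * f_term b h j k)"
proof -
  define A B C where "A = (norm (h $ j))\<^sup>2" and "B = (norm (row_without h k))\<^sup>2" and "C = cmod (corr h j k)"
  define q where "q = q_term h j k"
  have B: "0 \<le> B" by (simp add: B_def)
  note le' = le[folded A_def B_def C_def]
  have lnb: "ln b * log b y = ln y" for y using assms(1) by (simp add: log_def)
  consider "corr h j k = 0" | "corr h j k \<noteq> 0" "q = 1" | "corr h j k \<noteq> 0" "1 < q"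
    using q_term_ge_1[of h j k] by (fastforce simp: q_def)
  then show ?thesis
  proof cases
    case 1
    then show ?thesis using le'[of 0] by (simp add: f_term_def lnb A_def C_def correlated_bound_def)
  next
    case 2
    then have C: "0 < C" by (simp add: C_def)
    then have "2 * C = (1 + A) * (1 + B) - C\<^sup>2 - 1"
      using 2(2) by (simp add: q_def q_term_def A_def B_def C_def field_simps)
    then have "((\<lambda>r. real n * ln (correlated_bound A B C r)) \<longlongrightarrow> real n * ln ((1 + C) / (1 + B))) (at_left 1)"
      using B C by (intro tendsto_intros correlated_bound_limit) auto
    moreover have "eventually (\<lambda>r. X \<le> real n * ln (correlated_bound A B C r)) (at_left 1)"
      using eventually_at_left_real[OF zero_less_one] by (rule eventually_mono) (auto intro!: le')
    ultimately have "X \<le> real n * ln ((1 + C) / (1 + B))"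
      by (rule tendsto_lowerbound) auto
    then show ?thesis using 2 by (simp add: f_term_def lnb q_def[symmetric] B_def C_def)
  next
    case 3
    then have C: "0 < C" by (simp add: C_def)
    then have q: "2 * C * q = (1 + A) * (1 + B) - C\<^sup>2 - 1"
      by (simp add: q_def q_term_def A_def B_def C_def)
    note opt = correlated_bound_optimum[OF C B 3(2) q refl]
    show ?thesis
      using le'[of "q - sqrt (q\<^sup>2 - 1)"] opt 3 by (simp add: f_term_def lnb q_def[symmetric] B_def C_def)
  qed
qed

section \<open>The sum-rate bound\<close>

lemma num_messages_ge: "b powr (real n * R $ i) \<le> real (num_messages b R n i)"
  unfolding num_messages_def by linarith

lemma sum_rates_le:
  assumes b: "1 < b" and code: "is_code n (num_messages b R n) x d"
    and R: "\<And>i. 0 \<le> R $ i" and perm: "\<pi> permutes (UNIV :: 3 set)"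
  shows "(\<Sum>i\<in>UNIV. (1 - error_prob h n (num_messages b R n) x d i) * (real n * R $ i * ln b) - ln 2)
       \<le> real n * (ln b * (\<Sum>k\<in>UNIV. f_term b h k (\<pi> k)))"
proof -
  define M where "M = num_messages b R n"
  let ?J = "neg_entropy n (messages M)"
  have M_ge: "b powr (real n * R $ i) \<le> real (M i)" for i
    unfolding M_def by (rule num_messages_ge)
  have M: "0 < M i" for i
  proof -
    have "0 < b powr (real n * R $ i)" using b by simp
    then have "0 < real (M i)" using M_ge[of i] by linarith
    then show ?thesis by simp
  qed
  have power: "measure_pmf.expectation (messages M) (\<lambda>w. (\<Sum>t<n. (cmod (x i (w i) t))\<^sup>2) / real n) \<le> 1"
    and d: "d i \<in> measurable (PiM {..<n} (\<lambda>_. borel)) (count_space UNIV)" for i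
    using code by (auto simp: is_code_def M_def)
  have fano': "(1 - error_prob h n M x d i) * (real n * R $ i * ln b) - ln 2
     \<le> ?J (superpose (row_without h i) x) - ?J (superpose (h $ i) x)" for i
  proof -
    have "ln (b powr (real n * R $ i)) \<le> ln (real (M i))"
      using b M_ge[of i] by (intro ln_mono) auto
    then have "real n * R $ i * ln b \<le> ln (real (M i))"
      using b by (simp add: ln_powr)
    moreover have "0 \<le> 1 - error_prob h n M x d i"
    proof -
      interpret N: prob_space "noise n" by (rule prob_space_noise)
      interpret P: pair_prob_space "measure_pmf (messages M)" "noise n" ..
      show ?thesis by (simp add: error_prob_def)
    qed
    ultimately have "(1 - error_prob h n M x d i) * (real n * R $ i * ln b) - ln 2
      \<le> (1 - error_prob h n M x d i) * ln (real (M i)) - ln 2"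
      by (intro diff_right_mono mult_left_mono)
    also have "\<dots> \<le> ?J (superpose (row_without h i) x) - ?J (superpose (h $ i) x)"
      by (rule fano) (rule M, rule d)
    finally show ?thesis .
  qed
  have diff: "?J (superpose (row_without h k) x) - ?J (superpose (h $ j) x) \<le> real n * (ln b * f_term b h j k)" for j k
    unfolding corr_def[symmetric]
    by (rule le_f_term[OF b], unfold corr_def, rule neg_entropy_diff_le_correlated_bound) (rule M power | assumption)+
  have "(\<Sum>i\<in>UNIV. (1 - error_prob h n M x d i) * (real n * R $ i * ln b) - ln 2)
      \<le> (\<Sum>i\<in>UNIV. ?J (superpose (row_without h i) x) - ?J (superpose (h $ i) x))"
    by (intro sum_mono fano')
  \<comment> \<open>Only the interference terms are reindexed; the output terms keep their
    order.\<close>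
  also have "\<dots> = (\<Sum>k\<in>UNIV. ?J (superpose (row_without h (\<pi> k)) x) - ?J (superpose (h $ k) x))"
    using sum.permute[OF perm, of "\<lambda>i. ?J (superpose (row_without h i) x)"]
    by (simp add: sum_subtractf o_def)
  also have "\<dots> \<le> (\<Sum>k\<in>UNIV. real n * (ln b * f_term b h k (\<pi> k)))"
    by (intro sum_mono diff)
  finally show ?thesis by (simp add: M_def sum_distrib_left)
qed

lemma achievable_sum_le:
  assumes b: "1 < b" and "achievable b h R" and perm: "\<pi> permutes (UNIV :: 3 set)"
  shows "(\<Sum>i\<in>UNIV. R $ i) \<le> (\<Sum>k\<in>UNIV. f_term b h k (\<pi> k))"
proof -
  obtain x d where R: "\<And>i. 0 \<le> R $ i"
    and code: "\<And>n. is_code n (num_messages b R n) (x n) (d n)"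
    and err: "\<And>i. (\<lambda>n. error_prob h n (num_messages b R n) (x n) (d n) i) \<longlonglongrightarrow> 0"
    using assms(2) by (auto simp: achievable_def)
  define \<epsilon> where "\<epsilon> n i = error_prob h n (num_messages b R n) (x n) (d n) i" for n i
  have lhs: "(\<lambda>n. \<Sum>i\<in>UNIV. (1 - \<epsilon> n i) * R $ i) \<longlonglongrightarrow> (\<Sum>i\<in>UNIV. (1 - 0) * R $ i)"
    unfolding \<epsilon>_def by (intro tendsto_intros err)
  \<comment> \<open>Fano costs \<open>ln 2\<close> for each of the three users, which vanishes after
    division by \<open>real n * ln b\<close>.\<close>
  have rhs: "(\<lambda>n. (\<Sum>k\<in>UNIV. f_term b h k (\<pi> k)) + 3 * ln 2 / ln b / real n) \<longlonglongrightarrow> (\<Sum>k\<in>UNIV. f_term b h k (\<pi> k)) + 0"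
    by (intro tendsto_add tendsto_const lim_const_over_n)
  have "(\<Sum>i\<in>UNIV. (1 - \<epsilon> n i) * R $ i) \<le> (\<Sum>k\<in>UNIV. f_term b h k (\<pi> k)) + 3 * ln 2 / ln b / real n" if "1 \<le> n" for n
  proof -
    let ?c = "real n * ln b"
    have c: "0 < ?c" using that b by simp
    have "?c * (\<Sum>i\<in>UNIV. (1 - \<epsilon> n i) * R $ i) - 3 * ln 2
       = (\<Sum>i\<in>UNIV. (1 - \<epsilon> n i) * (real n * R $ i * ln b) - ln 2)"
      by (simp add: sum_subtractf sum_distrib_left mult_ac)
    also have "\<dots> \<le> ?c * (\<Sum>k\<in>UNIV. f_term b h k (\<pi> k))"
      using sum_rates_le[OF b code R perm] by (simp add: \<epsilon>_def mult.assoc)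
    finally have "(\<Sum>i\<in>UNIV. (1 - \<epsilon> n i) * R $ i) \<le> (?c * (\<Sum>k\<in>UNIV. f_term b h k (\<pi> k)) + 3 * ln 2) / ?c"
      using c by (simp add: pos_le_divide_eq mult.commute)
    also have "\<dots> = (\<Sum>k\<in>UNIV. f_term b h k (\<pi> k)) + 3 * ln 2 / ln b / real n"
      using b that by (simp add: add_divide_distrib mult.commute)
    finally show ?thesis .
  qed
  then show ?thesis
    using LIMSEQ_le[OF lhs rhs] by auto
qed

text \<open>For a fixed permutation the bound cuts out a closed half-space with the all-ones vector
  as normal, so it passes from achievable triplets to the closure of their convex hull.\<close>

lemma capacity_region_sum_le:
  assumes "1 < b" "\<pi> permutes (UNIV :: 3 set)" "R \<in> capacity_region b h"
  shows "(\<Sum>i\<in>UNIV. R $ i) \<le> (\<Sum>k\<in>UNIV. f_term b h k (\<pi> k))"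
proof -
  let ?F = "\<Sum>k\<in>UNIV. f_term b h k (\<pi> k)"
  define H where "H = {R :: real^3. inner 1 R \<le> ?F}"
  have eq: "inner 1 R = (\<Sum>i\<in>UNIV. R $ i)" for R :: "real^3"
    by (simp add: inner_vec_def)
  have "{R. achievable b h R} \<subseteq> H"
    using achievable_sum_le[OF assms(1) _ assms(2)] by (auto simp: H_def eq)
  then have "convex hull {R. achievable b h R} \<subseteq> H"
    by (rule hull_minimal) (simp add: H_def convex_halfspace_le)
  then have "closure (convex hull {R. achievable b h R}) \<subseteq> H"
    by (rule closure_minimal) (simp add: H_def closed_halfspace_le)
  then show ?thesis using assms(3) by (auto simp: capacity_region_def H_def eq)
qed

theorem theorem4:
  fixes b :: real and h :: "complex^3^3"
  assumes "1 < b"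
    and "\<And>i. h $ i $ i \<in> \<real>"
    and "\<And>i. 0 < Re (h $ i $ i)"
  shows "(\<forall>j k. corr h j k \<noteq> 0 \<longrightarrow> 1 \<le> q_term h j k) \<and>
         (\<forall>R \<in> capacity_region b h.
            R $ 1 + R $ 2 + R $ 3 \<le> (MIN \<pi> \<in> {\<pi>. \<pi> permutes (UNIV :: 3 set)}. \<Sum>k\<in>UNIV. f_term b h k (\<pi> k)))"
proof (intro conjI allI impI ballI)
  show "1 \<le> q_term h j k" if "corr h j k \<noteq> 0" for j k
    using that by (rule q_term_ge_1)
next
  fix R assume R: "R \<in> capacity_region b h"
  have "finite {\<pi>. \<pi> permutes (UNIV :: 3 set)}" by (rule finite_permutations) simp
  moreover have "{\<pi>. \<pi> permutes (UNIV :: 3 set)} \<noteq> {}" using permutes_id by blast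
  ultimately show "R $ 1 + R $ 2 + R $ 3 \<le> (MIN \<pi> \<in> {\<pi>. \<pi> permutes (UNIV :: 3 set)}. \<Sum>k\<in>UNIV. f_term b h k (\<pi> k))"
    using capacity_region_sum_le[OF assms(1) _ R] by (subst Min_ge_iff) (auto simp: sum_3)
qed

end
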